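(* Let $H$ be a graph. Then the following are equivalent: (i) $H$ is weakly norming; (ii) $t_H(\cdot)$ is a convex function on the set of graphons; (iii) for every $n\in\mathbb{N}$, the polynomial $P_{H,n}$ is convex on the set of matrices $A\in\mathcal{S}_n$ all of whose entries are positive.
   Context: A graphon is a symmetric measurable function $W:[0,1]^2\to[0,1]$; the set of graphons is a convex subset of the real vector space $\mathcal{W}$ of symmetric bounded measurable functions on $[0,1]^2$. For a graph $H$ and $W\in\mathcal{W}$, $t_H(W)=\int_{[0,1]^{V(H)}}\prod_{ij\in E(H)}W(x_i,x_j)\,d\mu^{v(H)}$, with $\mu$ Lebesgue measure. $H$ is weakly norming if $W\mapsto t_H(|W|)^{1/e(H)}$ is a norm on $\mathcal{W}$. $\mathcal{S}_n$ denotes the $\binom{n+1}{2}$-dimensional real vector space of $n\times n$ symmetric matrices, with coordinates $a_{ij}$, $i\le j$. For $A=(a_{ij})\in\mathcal{S}_n$, $P_{H,n}(A):=\sum_{\phi:V(H)\to[n]}\prod_{uv\in E(H)}a_{\phi(u)\phi(v)}$, a homogeneous polynomial of degree $e(H)$ in the $\binom{n+1}{2}$ variables. *)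

theory Defs
  imports "HOL-Analysis.Analysis" "Jordan_Normal_Form.Matrix"
begin

definition simple_graph :: "'v set \<Rightarrow> 'v set set \<Rightarrow> bool" where
  "simple_graph V E \<longleftrightarrow> finite V \<and> E \<subseteq> {e. e \<subseteq> V \<and> card e = 2}"

text \<open>The value of a function of two vertices on an unordered pair. It is meaningful when
  \<open>f u v = f v u\<close>, which holds wherever it is used below.\<close>

definition on_edge :: "('v \<Rightarrow> 'v \<Rightarrow> real) \<Rightarrow> 'v set \<Rightarrow> real" where
  "on_edge f e = (THE r. \<exists>u v. e = {u, v} \<and> r = f u v)"

lemma on_edge_eq:
  assumes "f u v = f v u"
  shows "on_edge f {u, v} = f u v"
  unfolding on_edge_def using assms by (intro the_equality) (auto simp: doubleton_eq_iff)

abbreviation unit_square :: "(real \<times> real) set" where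
  "unit_square \<equiv> {0..1} \<times> {0..1}"

text \<open>Functions on the unit square are represented by functions on the whole plane whose values
  outside the square are irrelevant.\<close>

definition kernels :: "(real \<times> real \<Rightarrow> real) set" where
  "kernels = {W. W \<in> borel_measurable (lebesgue_on unit_square) \<and>
                 (\<exists>B. \<forall>p\<in>unit_square. \<bar>W p\<bar> \<le> B) \<and>
                 (\<forall>x\<in>{0..1}. \<forall>y\<in>{0..1}. W (x, y) = W (y, x))}"

definition graphons :: "(real \<times> real \<Rightarrow> real) set" where
  "graphons = {W \<in> kernels. \<forall>p\<in>unit_square. 0 \<le> W p \<and> W p \<le> 1}"

text \<open>Kernels are Lebesgue measurable, so the product measure has to be completed: otherwise
  \<open>\<lambda>x. W (x u, x v)\<close> need not be measurable, and the Bochner integral would be \<open>0\<close> by default.\<close>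

definition lebesgue_cube :: "'v set \<Rightarrow> ('v \<Rightarrow> real) measure" where
  "lebesgue_cube V = completion (Pi\<^sub>M V (\<lambda>_. restrict_space lborel {0..1}))"

definition hom_density :: "'v set \<Rightarrow> 'v set set \<Rightarrow> (real \<times> real \<Rightarrow> real) \<Rightarrow> real" where
  "hom_density V E W =
     (LINT x|lebesgue_cube V. (\<Prod>e\<in>E. on_edge (\<lambda>u v. W (x u, x v)) e))"

text \<open>As usual for function spaces, definiteness is understood up to null sets.\<close>

definition norm_on_kernels :: "((real \<times> real \<Rightarrow> real) \<Rightarrow> real) \<Rightarrow> bool" where
  "norm_on_kernels N \<longleftrightarrow>
     (\<forall>W\<in>kernels. 0 \<le> N W) \<and>
     (\<forall>W\<in>kernels. N W = 0 \<longleftrightarrow> (AE p in lebesgue_on unit_square. W p = 0)) \<and>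
     (\<forall>W\<in>kernels. \<forall>c. N (\<lambda>p. c * W p) = \<bar>c\<bar> * N W) \<and>
     (\<forall>U\<in>kernels. \<forall>W\<in>kernels. N (\<lambda>p. U p + W p) \<le> N U + N W)"

definition weakly_norming :: "'v set \<Rightarrow> 'v set set \<Rightarrow> bool" where
  "weakly_norming V E \<longleftrightarrow>
     norm_on_kernels (\<lambda>W. hom_density V E (\<lambda>p. \<bar>W p\<bar>) powr (1 / real (card E)))"

definition hom_poly :: "'v set \<Rightarrow> 'v set set \<Rightarrow> nat \<Rightarrow> real mat \<Rightarrow> real" where
  "hom_poly V E n A =
     (\<Sum>\<phi>\<in>V \<rightarrow>\<^sub>E {..<n}. \<Prod>e\<in>E. on_edge (\<lambda>u v. A $$ (\<phi> u, \<phi> v)) e)"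

definition sym_mats :: "nat \<Rightarrow> real mat set" where
  "sym_mats n = {A \<in> carrier_mat n n. transpose_mat A = A}"

definition pos_sym_mats :: "nat \<Rightarrow> real mat set" where
  "pos_sym_mats n = {A \<in> sym_mats n. \<forall>i<n. \<forall>j<n. 0 < A $$ (i, j)}"

text \<open>Neither functions nor matrices of varying dimension are an instance of class
  \<open>real_vector\<close>, so \<^const>\<open>convex_on\<close> is restated with explicit vector space operations.\<close>

definition convex_fun_on ::
    "('a \<Rightarrow> 'a \<Rightarrow> 'a) \<Rightarrow> (real \<Rightarrow> 'a \<Rightarrow> 'a) \<Rightarrow> 'a set \<Rightarrow> ('a \<Rightarrow> real) \<Rightarrow> bool" where
  "convex_fun_on vadd smul S f \<longleftrightarrow>
     (\<forall>x\<in>S. \<forall>y\<in>S. \<forall>a\<ge>0. \<forall>b\<ge>0. a + b = 1 \<longrightarrow>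
        vadd (smul a x) (smul b y) \<in> S \<and>
        f (vadd (smul a x) (smul b y)) \<le> a * f x + b * f y)"

abbreviation convex_on_graphons :: "((real \<times> real \<Rightarrow> real) \<Rightarrow> real) \<Rightarrow> bool" where
  "convex_on_graphons \<equiv>
     convex_fun_on (\<lambda>U W p. U p + W p) (\<lambda>c W p. c * W p) graphons"

abbreviation convex_on_pos_sym_mats :: "nat \<Rightarrow> (real mat \<Rightarrow> real) \<Rightarrow> bool" where
  "convex_on_pos_sym_mats n \<equiv> convex_fun_on (+) (\<cdot>\<^sub>m) (pos_sym_mats n)"

lemma graphons_convex:
  assumes "U \<in> graphons" "W \<in> graphons" "0 \<le> a" "0 \<le> b" "a + b = 1"
  shows "(\<lambda>p. a * U p + b * W p) \<in> graphons"
proof -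
  have *: "0 \<le> a * U p + b * W p \<and> a * U p + b * W p \<le> 1" if "p \<in> unit_square" for p
  proof -
    have "0 \<le> U p" "U p \<le> 1" "0 \<le> W p" "W p \<le> 1"
      using assms(1,2) that unfolding graphons_def by blast+
    then have "a * U p \<le> a * 1" "b * W p \<le> b * 1" "0 \<le> a * U p" "0 \<le> b * W p"
      using assms(3,4) by (simp_all only: mult_left_mono mult_nonneg_nonneg)
    then show ?thesis using assms(5) by linarith
  qed
  have "\<forall>p\<in>unit_square. \<bar>a * U p + b * W p\<bar> \<le> 1"
    using * by (metis abs_of_nonneg)
  moreover have "(\<lambda>p. a * U p + b * W p) \<in> borel_measurable (lebesgue_on unit_square)"
    using assms(1,2) unfolding graphons_def kernels_def by auto
  moreover have "\<forall>x\<in>{0..1}. \<forall>y\<in>{0..1}. a * U (x, y) + b * W (x, y) = a * U (y, x) + b * W (y, x)"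
    using assms(1,2) unfolding graphons_def kernels_def by simp
  ultimately show ?thesis
    unfolding graphons_def kernels_def using * by blast
qed

lemma pos_sym_mats_convex:
  assumes "A \<in> pos_sym_mats n" "B \<in> pos_sym_mats n" "0 \<le> a" "0 \<le> b" "a + b = (1::real)"
  shows "a \<cdot>\<^sub>m A + b \<cdot>\<^sub>m B \<in> pos_sym_mats n"
proof -
  have c: "A \<in> carrier_mat n n" "B \<in> carrier_mat n n"
    and s: "transpose_mat A = A" "transpose_mat B = B"
    and p: "\<And>i j. i < n \<Longrightarrow> j < n \<Longrightarrow> 0 < A $$ (i, j) \<and> 0 < B $$ (i, j)"
    using assms(1,2) by (auto simp: pos_sym_mats_def sym_mats_def)
  have t: "A $$ (i, j) = A $$ (j, i)" "B $$ (i, j) = B $$ (j, i)" if "i < n" "j < n" for i j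
    using s c that by (metis carrier_matD index_transpose_mat(1))+
  have "transpose_mat (a \<cdot>\<^sub>m A + b \<cdot>\<^sub>m B) = a \<cdot>\<^sub>m A + b \<cdot>\<^sub>m B"
    using c t by (intro eq_matI) auto
  moreover have "0 < a * A $$ (i, j) + b * B $$ (i, j)" if "i < n" "j < n" for i j
  proof (cases "a = 0")
    case True
    then show ?thesis using assms(5) p[OF that] by simp
  next
    case False
    then show ?thesis using assms(3,4) p[OF that] by (intro add_pos_nonneg) auto
  qed
  ultimately show ?thesis
    using c by (auto simp: pos_sym_mats_def sym_mats_def)
qed

end

theory Submission
  imports Defs "HOL-Probability.Infinite_Product_Measure"
begin

text \<open>
  A norm composed with \<open>x \<mapsto> x ^ e(H)\<close> is convex; conversely, convexity and homogeneity of \<open>t\<^sub>H\<close> make its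
  unit ball on nonnegative kernels convex, which is the triangle inequality. Matrices and graphons
  are linked by step kernels, whose density is \<open>P\<^sub>H\<^sub>,\<^sub>n(A) / n ^ v(H)\<close>: every graphon is an almost
  everywhere limit of positive ones, obtained by sampling continuous approximants on fine grids,
  and dominated convergence applies.

  Definiteness comes from a Sidorenko-type bound. Relabelling the cells of a step kernel preserves its
  density, so the triangle inequality lets one average over all permutations of the cells. The average
  is constant off the diagonal blocks, and these blocks disappear in the limit; hence
  \<open>t\<^sub>H(W) \<ge> (\<integral>W) ^ e(H)\<close>, which is positive unless \<open>W = 0\<close> almost everywhere.
\<close>

section \<open>Pairs of coordinates of the cube\<close>

text \<open>Three obstacles shape the proof. Kernels are only Lebesgue measurable, so
  \<open>W (x u, x v)\<close> cannot be treated as a composition of Borel maps; what helps is that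
  for distinct vertices the pair of coordinates is uniformly distributed on the square, so that null
  sets pull back to null sets. The matrices in (iii) are strictly positive whereas graphons may
  vanish, so the approximants are kept above \<open>1 / (n + 1)\<close>. Finally, permutations of
  the cells never carry an off-diagonal pair of cells to a diagonal one. Averaging over them
  therefore cannot produce a constant kernel, and the diagonal blocks, of total measure
  \<open>1 / m\<close>, have to be carried along as an error.\<close>

abbreviation unit_interval :: "real measure" where
  "unit_interval \<equiv> restrict_space lborel {0..1}"

lemma prob_space_unit_interval: "prob_space unit_interval"
  by (rule prob_spaceI) (simp add: emeasure_restrict_space space_restrict_space)

lemma space_lebesgue_cube: "space (lebesgue_cube V) = V \<rightarrow>\<^sub>E {0..1}"
  by (simp add: lebesgue_cube_def space_PiM space_restrict_space)

lemma prob_space_lebesgue_cube: "prob_space (lebesgue_cube V)"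
  unfolding lebesgue_cube_def
  by (intro prob_space.prob_space_completion prob_space_PiM prob_space_unit_interval)

lemma measurable_PiM_pair:
  assumes "u \<in> V" "v \<in> V"
  shows "(\<lambda>x. (x u, x v)) \<in> Pi\<^sub>M V (\<lambda>_. unit_interval) \<rightarrow>\<^sub>M borel"
proof -
  have "(\<lambda>x. x w) \<in> Pi\<^sub>M V (\<lambda>_. unit_interval) \<rightarrow>\<^sub>M borel" if "w \<in> V" for w
    using measurable_component_singleton[OF that, of "\<lambda>_. unit_interval"]
    by (simp add: measurable_restrict_space2_iff)
  then show ?thesis using assms by simp
qed

lemma measurable_cube_pair:
  assumes "u \<in> V" "v \<in> V"
  shows "(\<lambda>x. (x u, x v)) \<in> lebesgue_cube V \<rightarrow>\<^sub>M borel"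
  unfolding lebesgue_cube_def using assms by (intro measurable_completion measurable_PiM_pair)

text \<open>Distinctness of \<open>u\<close> and \<open>v\<close> is essential: for
  \<open>u = v\<close> the image would be concentrated on the diagonal, a null set of the square.
  The two measures are compared on rectangles, where the cube measure factors over the
  vertices.\<close>

lemma distr_cube_pair:
  assumes "finite V" "u \<in> V" "v \<in> V" "u \<noteq> v"
  shows "distr (lebesgue_cube V) borel (\<lambda>x. (x u, x v)) = density lborel (indicator unit_square)"
proof -
  \<comment> \<open>The uniform distribution on the unit interval, taken as a measure on the whole
    line, so that \<open>D \<Otimes>\<^sub>M D\<close> has the sigma-algebra of the image
    measure.\<close>
  define D where "D = density lborel (indicator {0..1::real} :: real \<Rightarrow> ennreal)"
  interpret I: prob_space unit_interval by (rule prob_space_unit_interval)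
  interpret P: product_sigma_finite "\<lambda>_::'a. unit_interval" by standard
  have emD: "emeasure D A = emeasure lborel (A \<inter> {0..1})" if "A \<in> sets borel" for A
    using that by (simp add: D_def emeasure_density nn_integral_indicator mult.commute
        indicator_inter_arith[symmetric] Int_commute)
  have sfD: "sigma_finite_measure D"
  proof -
    interpret prob_space D
      by (rule prob_spaceI) (simp add: emD D_def[THEN arg_cong, of space])
    show ?thesis by unfold_locales
  qed
  let ?f = "\<lambda>x. (x u, x v)"
  have meas: "?f \<in> Pi\<^sub>M V (\<lambda>_. unit_interval) \<rightarrow>\<^sub>M borel"
    using assms by (intro measurable_PiM_pair)
  have "distr (lebesgue_cube V) borel ?f = distr (Pi\<^sub>M V (\<lambda>_. unit_interval)) borel ?f"
    unfolding lebesgue_cube_def by (rule distr_completion[OF meas])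
  also have "\<dots> = D \<Otimes>\<^sub>M D"
  proof (rule pair_measure_eqI[symmetric, OF sfD sfD])
    have "sets (D \<Otimes>\<^sub>M D) = sets (borel \<Otimes>\<^sub>M borel)"
      by (intro sets_pair_measure_cong) (simp_all add: D_def)
    then show "sets (D \<Otimes>\<^sub>M D) = sets (distr (Pi\<^sub>M V (\<lambda>_. unit_interval)) borel ?f)"
      unfolding sets_distr by (subst (asm) borel_prod)
  next
    fix A B assume "A \<in> sets D" "B \<in> sets D"
    then have AB: "A \<in> sets borel" "B \<in> sets borel" by (simp_all add: D_def)
    \<comment> \<open>The preimage of \<open>A \<times> B\<close> is the box with sides
      \<open>C w\<close>; vertices other than \<open>u\<close> and \<open>v\<close> contribute the
      factor 1.\<close>
    define C where "C w = (if w = u then A \<inter> {0..1} else if w = v then B \<inter> {0..1} else {0..1})" for w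
    have C: "C w \<in> sets unit_interval" for w
      using AB by (auto simp: C_def sets_restrict_space_iff)
    have "A \<times> B \<in> sets borel"
      using AB by (simp add: borel_prod[symmetric])
    then have "emeasure (distr (Pi\<^sub>M V (\<lambda>_. unit_interval)) borel ?f) (A \<times> B) =
        emeasure (Pi\<^sub>M V (\<lambda>_. unit_interval)) (?f -` (A \<times> B) \<inter> space (Pi\<^sub>M V (\<lambda>_. unit_interval)))"
      by (rule emeasure_distr[OF meas])
    also have "?f -` (A \<times> B) \<inter> space (Pi\<^sub>M V (\<lambda>_. unit_interval)) = Pi\<^sub>E V C"
      using assms by (auto simp: space_PiM C_def PiE_iff split: if_splits)
    also have "emeasure (Pi\<^sub>M V (\<lambda>_. unit_interval)) (Pi\<^sub>E V C) = (\<Prod>w\<in>V. emeasure unit_interval (C w))"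
      using assms C by (intro P.emeasure_PiM) auto
    also have "\<dots> = (\<Prod>w\<in>{u, v}. emeasure unit_interval (C w))"
      using assms by (intro prod.mono_neutral_right)
        (auto simp: C_def emeasure_restrict_space)
    also have "\<dots> = emeasure D A * emeasure D B"
      using assms AB by (simp add: C_def emD emeasure_restrict_space)
    finally show "emeasure D A * emeasure D B =
      emeasure (distr (Pi\<^sub>M V (\<lambda>_. unit_interval)) borel ?f) (A \<times> B)" by simp
  qed
  also have "\<dots> = density (lborel \<Otimes>\<^sub>M lborel) (\<lambda>(x, y). indicator {0..1} x * indicator {0..1} y)"
    unfolding D_def using sfD lborel.sigma_finite_measure_axioms
    by (intro pair_measure_density) (simp_all add: D_def)
  also have "\<dots> = density lborel (indicator unit_square)"
    unfolding lborel_prod by (intro arg_cong[where f = "density lborel"]) (auto simp: indicator_def)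
  finally show ?thesis .
qed

lemma unit_square_lebesgue: "unit_square \<in> sets lebesgue"
proof -
  have "unit_square = cbox (0, 0) (1, 1)"
    by (auto simp: cbox_Pair_eq)
  then show ?thesis by simp
qed

lemma AE_lebesgue_on_unit_square:
  "(AE p in lebesgue_on unit_square. P p) \<longleftrightarrow> (AE p in lborel. p \<in> unit_square \<longrightarrow> P p)"
  using unit_square_lebesgue by (simp add: AE_restrict_space_iff AE_completion_iff)

text \<open>Links the completed measure on which kernels live with the Borel measure of
  \<open>distr_cube_pair\<close>: completion does not change almost-everywhere statements.\<close>

lemma AE_unit_square_iff:
  "(AE p in lebesgue_on unit_square. P p) \<longleftrightarrow> (AE p in density lborel (indicator unit_square). P p)"
proof -
  have "closed unit_square" by (intro closed_Times) auto
  then have "(indicator unit_square :: real \<times> real \<Rightarrow> ennreal) \<in> borel_measurable lborel"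
    by (intro borel_measurable_indicator) auto
  then have "(AE p in density lborel (indicator unit_square). P p) \<longleftrightarrow>
      (AE p in lborel. p \<in> unit_square \<longrightarrow> P p)"
    by (subst AE_density) (auto simp: indicator_def intro!: AE_cong)
  then show ?thesis
    by (simp add: AE_lebesgue_on_unit_square)
qed

lemma AE_cube_pairI:
  assumes "finite V" "u \<in> V" "v \<in> V" "u \<noteq> v" "AE p in lebesgue_on unit_square. P p"
  shows "AE x in lebesgue_cube V. P (x u, x v)"
proof -
  have "AE p in distr (lebesgue_cube V) borel (\<lambda>x. (x u, x v)). P p"
    using assms(5) unfolding distr_cube_pair[OF assms(1-4)] AE_unit_square_iff .
  with assms show ?thesis
    by (intro AE_distrD[OF measurable_cube_pair[of u V v]])
qed

text \<open>Composing with a Lebesgue measurable function need not give a measurable function. Here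
  it does, because the cube is complete and the coordinate pair pulls Lebesgue null sets back to
  null sets, which makes it measurable into \<open>lebesgue\<close>.\<close>

lemma measurable_kernel_cube:
  assumes "finite V" "u \<in> V" "v \<in> V" "u \<noteq> v"
    and W: "W \<in> borel_measurable (lebesgue_on unit_square)"
  shows "(\<lambda>x. W (x u, x v)) \<in> borel_measurable (lebesgue_cube V)"
proof -
  interpret complete_measure "lebesgue_cube V"
    unfolding lebesgue_cube_def ..
  have "null_sets lborel \<subseteq> null_sets (distr (lebesgue_cube V) lborel (\<lambda>x. (x u, x v)))"
  proof
    fix N :: "(real \<times> real) set" assume N: "N \<in> null_sets lborel"
    then have "AE p in lebesgue_on unit_square. p \<notin> N"
      unfolding AE_lebesgue_on_unit_square by (auto dest!: AE_not_in)
    then have "AE p in density lborel (indicator unit_square). p \<notin> N"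
      by (simp only: AE_unit_square_iff)
    then have "N \<in> null_sets (density lborel (indicator unit_square))"
      using N by (subst Measure_Space.AE_iff_null_sets) auto
    moreover have "distr (lebesgue_cube V) lborel (\<lambda>x. (x u, x v)) =
        distr (lebesgue_cube V) borel (\<lambda>x. (x u, x v))"
      by (rule distr_cong) auto
    ultimately show "N \<in> null_sets (distr (lebesgue_cube V) lborel (\<lambda>x. (x u, x v)))"
      unfolding distr_cube_pair[OF assms(1-4)] by simp
  qed
  with assms have "(\<lambda>x. (x u, x v)) \<in> lebesgue_cube V \<rightarrow>\<^sub>M lebesgue"
    by (intro measurable_completion2) (auto simp: measurable_cube_pair)
  moreover have "(\<lambda>x. (x u, x v)) \<in> space (lebesgue_cube V) \<rightarrow> unit_square"
    using assms by (auto simp: space_lebesgue_cube PiE_iff)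
  ultimately have "(\<lambda>x. (x u, x v)) \<in> lebesgue_cube V \<rightarrow>\<^sub>M lebesgue_on unit_square"
    by (simp add: measurable_restrict_space2_iff)
  from measurable_compose[OF this W] show ?thesis .
qed

text \<open>Transport from the cube back to the square via \<open>AE_distr_iff\<close> needs a Borel
  zero set, so \<open>W\<close> is first exchanged for a Borel function that agrees with it almost
  everywhere.\<close>

lemma AE_cube_kernel_eq_0D:
  assumes "finite V" "u \<in> V" "v \<in> V" "u \<noteq> v"
    and W: "W \<in> borel_measurable (lebesgue_on unit_square)"
    and "AE x in lebesgue_cube V. W (x u, x v) = (0::real)"
  shows "AE p in lebesgue_on unit_square. W p = 0"
proof -
  \<comment> \<open>Values outside the square are arbitrary and need not be measurable, so they are
    set to 0 first.\<close>
  let ?W = "\<lambda>p. if p \<in> unit_square then W p else 0"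
  have "?W \<in> borel_measurable lebesgue"
    using W unit_square_lebesgue by (simp add: borel_measurable_if)
  then obtain W' where W'[measurable]: "W' \<in> borel_measurable lborel" and "AE p in lborel. ?W p = W' p"
    using completion_ex_borel_measurable_real by blast
  then have eq: "AE p in lebesgue_on unit_square. W p = W' p"
    unfolding AE_lebesgue_on_unit_square by eventually_elim auto
  have "AE x in lebesgue_cube V. W' (x u, x v) = 0"
    using AE_cube_pairI[OF assms(1-4) eq] assms(6) by eventually_elim simp
  then have "AE p in distr (lebesgue_cube V) borel (\<lambda>x. (x u, x v)). W' p = 0"
    using W' by (subst AE_distr_iff) (auto intro!: measurable_cube_pair assms)
  then have "AE p in lebesgue_on unit_square. W' p = 0"
    unfolding distr_cube_pair[OF assms(1-4)] AE_unit_square_iff .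
  with eq show ?thesis by eventually_elim simp
qed

section \<open>Homomorphism densities of kernels\<close>

lemma kernels_add: "U \<in> kernels \<Longrightarrow> W \<in> kernels \<Longrightarrow> (\<lambda>p. U p + W p) \<in> kernels"
proof -
  assume U: "U \<in> kernels" and W: "W \<in> kernels"
  then obtain B C where "\<forall>p\<in>unit_square. \<bar>U p\<bar> \<le> B" "\<forall>p\<in>unit_square. \<bar>W p\<bar> \<le> C"
    unfolding kernels_def by blast
  then have "\<forall>p\<in>unit_square. \<bar>U p + W p\<bar> \<le> B + C"
    by (meson abs_triangle_ineq add_mono order_trans)
  with U W show ?thesis
    unfolding kernels_def by auto
qed

lemma kernels_scale: "W \<in> kernels \<Longrightarrow> (\<lambda>p. c * W p) \<in> kernels"
proof -
  assume W: "W \<in> kernels"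
  then obtain B where "\<forall>p\<in>unit_square. \<bar>W p\<bar> \<le> B"
    unfolding kernels_def by blast
  then have "\<forall>p\<in>unit_square. \<bar>c * W p\<bar> \<le> \<bar>c\<bar> * B"
    by (auto simp: abs_mult intro: mult_left_mono)
  with W show ?thesis
    unfolding kernels_def by auto
qed

lemma kernels_abs: "W \<in> kernels \<Longrightarrow> (\<lambda>p. \<bar>W p\<bar>) \<in> kernels"
  unfolding kernels_def by auto

lemma kernels_const: "(\<lambda>p. c) \<in> kernels"
  unfolding kernels_def by auto

lemma kernels_sum: "finite I \<Longrightarrow> (\<And>i. i \<in> I \<Longrightarrow> U i \<in> kernels) \<Longrightarrow> (\<lambda>p. \<Sum>i\<in>I. U i p) \<in> kernels"
  by (induction I rule: finite_induct) (auto intro: kernels_const kernels_add)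

lemma graphons_kernels: "W \<in> graphons \<Longrightarrow> W \<in> kernels"
  by (simp add: graphons_def)

text \<open>The bound is strictly positive because later arguments divide by it to turn a kernel
  into a graphon.\<close>

lemma kernels_bound:
  assumes "W \<in> kernels"
  obtains B where "B > 0" "\<And>p. p \<in> unit_square \<Longrightarrow> \<bar>W p\<bar> \<le> B"
proof -
  from assms obtain B where "\<forall>p\<in>unit_square. \<bar>W p\<bar> \<le> B"
    unfolding kernels_def by blast
  then show ?thesis by (intro that[of "max 1 B"]) (auto simp: max.coboundedI2)
qed

text \<open>For an edgeless graph the equivalence fails: density and polynomials are constant, hence
  convex, but the functional in \<open>weakly_norming\<close> takes the value 1 at the zero
  kernel.\<close>

locale edged_graph =
  fixes V :: "'v set" and E :: "'v set set"
  assumes simple_graph: "simple_graph V E" and edges_nonempty: "E \<noteq> {}"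
begin

lemma finite_vertices: "finite V"
  using simple_graph by (simp add: simple_graph_def)

lemma finite_edges: "finite E"
  using simple_graph finite_subset[of E "Pow V"] by (auto simp: simple_graph_def)

lemma card_edges_pos: "card E > 0"
  using finite_edges edges_nonempty by (simp add: card_gt_0_iff)

lemma edgeE:
  assumes "e \<in> E"
  obtains u v where "e = {u, v}" "u \<in> V" "v \<in> V" "u \<noteq> v"
  using assms simple_graph by (auto simp: simple_graph_def card_2_iff subset_iff)

lemma on_edge_kernel:
  assumes "W \<in> kernels" "x \<in> V \<rightarrow>\<^sub>E {0..1}" "u \<in> V" "v \<in> V"
  shows "on_edge (\<lambda>u v. W (x u, x v)) {u, v} = W (x u, x v)"
proof (rule on_edge_eq)
  have "x u \<in> {0..1}" "x v \<in> {0..1}" using assms by auto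
  then show "W (x u, x v) = W (x v, x u)"
    using assms(1) unfolding kernels_def by blast
qed

definition edge_product :: "(real \<times> real \<Rightarrow> real) \<Rightarrow> ('v \<Rightarrow> real) \<Rightarrow> real" where
  "edge_product W x = (\<Prod>e\<in>E. on_edge (\<lambda>u v. W (x u, x v)) e)"

lemma hom_density_eq: "hom_density V E W = (LINT x|lebesgue_cube V. edge_product W x)"
  by (simp add: hom_density_def edge_product_def)

text \<open>The point \<open>p\<close> does not depend on \<open>W\<close>, so different kernels can
  be compared on one edge at the same point.\<close>

lemma on_edge_kernelE:
  assumes "x \<in> V \<rightarrow>\<^sub>E {0..1}" "e \<in> E"
  obtains p where "p \<in> unit_square" "\<And>W. W \<in> kernels \<Longrightarrow> on_edge (\<lambda>u v. W (x u, x v)) e = W p"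
proof -
  obtain u v where e: "e = {u, v}" "u \<in> V" "v \<in> V" using assms(2) by (rule edgeE)
  have "(x u, x v) \<in> unit_square" using assms(1) e by auto
  then show ?thesis using on_edge_kernel[OF _ assms(1) e(2,3)] e(1) that by blast
qed

lemma measurable_edge_product:
  assumes "W \<in> kernels"
  shows "edge_product W \<in> borel_measurable (lebesgue_cube V)"
  unfolding edge_product_def
proof (rule borel_measurable_prod)
  fix e assume "e \<in> E"
  then obtain u v where e: "e = {u, v}" "u \<in> V" "v \<in> V" "u \<noteq> v" by (rule edgeE)
  have "(\<lambda>x. W (x u, x v)) \<in> borel_measurable (lebesgue_cube V)"
    using assms e finite_vertices by (intro measurable_kernel_cube) (auto simp: kernels_def)
  also have "?this \<longleftrightarrow> (\<lambda>x. on_edge (\<lambda>u v. W (x u, x v)) e) \<in> borel_measurable (lebesgue_cube V)"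
    using on_edge_kernel[OF assms _ e(2,3)] e(1)
    by (intro measurable_cong) (simp add: space_lebesgue_cube)
  finally show "(\<lambda>x. on_edge (\<lambda>u v. W (x u, x v)) e) \<in> borel_measurable (lebesgue_cube V)" .
qed

lemma abs_edge_product_le:
  assumes "W \<in> kernels" "x \<in> V \<rightarrow>\<^sub>E {0..1}" "\<And>p. p \<in> unit_square \<Longrightarrow> \<bar>W p\<bar> \<le> B"
  shows "\<bar>edge_product W x\<bar> \<le> B ^ card E"
proof -
  have "\<bar>on_edge (\<lambda>u v. W (x u, x v)) e\<bar> \<le> B" if e: "e \<in> E" for e
  proof -
    obtain p where "p \<in> unit_square"
      "\<And>W. W \<in> kernels \<Longrightarrow> on_edge (\<lambda>u v. W (x u, x v)) e = W p"
      using on_edge_kernelE[OF assms(2) e] by blast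
    with assms(1,3) show ?thesis by simp
  qed
  then have "(\<Prod>e\<in>E. \<bar>on_edge (\<lambda>u v. W (x u, x v)) e\<bar>) \<le> (\<Prod>e\<in>E. B)"
    by (intro prod_mono) auto
  then show ?thesis by (simp add: edge_product_def abs_prod)
qed

lemma integrable_edge_product:
  assumes "W \<in> kernels"
  shows "integrable (lebesgue_cube V) (edge_product W)"
proof -
  interpret prob_space "lebesgue_cube V" by (rule prob_space_lebesgue_cube)
  obtain B where "\<And>p. p \<in> unit_square \<Longrightarrow> \<bar>W p\<bar> \<le> B" using kernels_bound[OF assms] by blast
  then show ?thesis
    using measurable_edge_product[OF assms] abs_edge_product_le[OF assms]
    by (intro integrable_const_bound[where B = "B ^ card E"]) (auto intro!: AE_I2 simp: space_lebesgue_cube)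
qed

lemma hom_density_mono:
  assumes "U \<in> kernels" "W \<in> kernels" "\<And>p. p \<in> unit_square \<Longrightarrow> 0 \<le> U p \<and> U p \<le> W p"
  shows "hom_density V E U \<le> hom_density V E W"
  unfolding hom_density_eq
proof (rule integral_mono[OF integrable_edge_product[OF assms(1)] integrable_edge_product[OF assms(2)]])
  fix x assume "x \<in> space (lebesgue_cube V)"
  then have x: "x \<in> V \<rightarrow>\<^sub>E {0..1}" by (simp add: space_lebesgue_cube)
  show "edge_product U x \<le> edge_product W x"
    unfolding edge_product_def
  proof (rule prod_mono)
    fix e assume "e \<in> E"
    then obtain p where "p \<in> unit_square"
      "\<And>W. W \<in> kernels \<Longrightarrow> on_edge (\<lambda>u v. W (x u, x v)) e = W p"
      using on_edge_kernelE[OF x] by blast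
    with assms show "0 \<le> on_edge (\<lambda>u v. U (x u, x v)) e \<and>
        on_edge (\<lambda>u v. U (x u, x v)) e \<le> on_edge (\<lambda>u v. W (x u, x v)) e"
      by simp
  qed
qed

lemma hom_density_cong:
  assumes "U \<in> kernels" "W \<in> kernels" "\<And>p. p \<in> unit_square \<Longrightarrow> U p = W p"
  shows "hom_density V E U = hom_density V E W"
  unfolding hom_density_eq edge_product_def
proof (intro Bochner_Integration.integral_cong refl prod.cong)
  fix x e assume "x \<in> space (lebesgue_cube V)" "e \<in> E"
  then obtain p where "p \<in> unit_square"
    "\<And>W. W \<in> kernels \<Longrightarrow> on_edge (\<lambda>u v. W (x u, x v)) e = W p"
    using on_edge_kernelE[of x e] unfolding space_lebesgue_cube by blast
  with assms show "on_edge (\<lambda>u v. U (x u, x v)) e = on_edge (\<lambda>u v. W (x u, x v)) e"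
    by simp
qed

lemma hom_density_scale:
  assumes "W \<in> kernels"
  shows "hom_density V E (\<lambda>p. c * W p) = c ^ card E * hom_density V E W"
proof -
  have "edge_product (\<lambda>p. c * W p) x = c ^ card E * edge_product W x" if "x \<in> space (lebesgue_cube V)" for x
  proof -
    have "on_edge (\<lambda>u v. c * W (x u, x v)) e = c * on_edge (\<lambda>u v. W (x u, x v)) e" if "e \<in> E" for e
    proof -
      obtain p where p: "\<And>W. W \<in> kernels \<Longrightarrow> on_edge (\<lambda>u v. W (x u, x v)) e = W p"
        using on_edge_kernelE[OF \<open>x \<in> _\<close>[unfolded space_lebesgue_cube] \<open>e \<in> E\<close>] by blast
      show ?thesis
        using p[OF assms] p[OF kernels_scale[OF assms, of c]] by simp
    qed
    then show ?thesis by (simp add: edge_product_def prod.distrib cong: prod.cong)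
  qed
  then show ?thesis
    unfolding hom_density_eq by (simp cong: Bochner_Integration.integral_cong)
qed

lemma hom_density_const: "hom_density V E (\<lambda>p. c) = c ^ card E"
proof -
  interpret prob_space "lebesgue_cube V" by (rule prob_space_lebesgue_cube)
  have "on_edge (\<lambda>u v. c) e = c" if "e \<in> E" for e
    using that by (elim edgeE) (simp add: on_edge_eq)
  then show ?thesis by (simp add: hom_density_eq edge_product_def prob_space)
qed

lemma hom_density_nonneg:
  assumes "W \<in> kernels" "\<And>p. p \<in> unit_square \<Longrightarrow> 0 \<le> W p"
  shows "0 \<le> hom_density V E W"
  using hom_density_mono[of "\<lambda>_. 0" W] assms card_edges_pos
  by (simp add: kernels_const hom_density_const zero_power)

lemma AE_edges:
  assumes "AE p in lebesgue_on unit_square. P p"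
  shows "AE x in lebesgue_cube V. \<forall>e\<in>E. \<exists>u v. e = {u, v} \<and> u \<in> V \<and> v \<in> V \<and> P (x u, x v)"
proof (rule AE_finite_allI[OF finite_edges])
  fix e assume "e \<in> E"
  then obtain u v where e: "e = {u, v}" "u \<in> V" "v \<in> V" "u \<noteq> v" by (rule edgeE)
  then have "AE x in lebesgue_cube V. P (x u, x v)"
    using assms finite_vertices by (intro AE_cube_pairI)
  then show "AE x in lebesgue_cube V. \<exists>u v. e = {u, v} \<and> u \<in> V \<and> v \<in> V \<and> P (x u, x v)"
    by (rule eventually_mono) (use e in blast)
qed

text \<open>Dominated convergence on the cube. The exceptional null set of the square becomes
  finitely many null sets of the cube, one per edge, and the uniform bound supplies a constant
  majorant.\<close>

lemma hom_density_tendsto: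
  assumes Wn: "\<And>n. W n \<in> kernels" and W: "U \<in> kernels"
    and bound: "\<And>n p. p \<in> unit_square \<Longrightarrow> \<bar>W n p\<bar> \<le> B"
    and lim: "AE p in lebesgue_on unit_square. (\<lambda>n. W n p) \<longlonglongrightarrow> U p"
  shows "(\<lambda>n. hom_density V E (W n)) \<longlonglongrightarrow> hom_density V E U"
  unfolding hom_density_eq
proof (rule integral_dominated_convergence[where w = "\<lambda>_. B ^ card E"])
  interpret prob_space "lebesgue_cube V" by (rule prob_space_lebesgue_cube)
  show "integrable (lebesgue_cube V) (\<lambda>_. B ^ card E)" by simp
  show "AE x in lebesgue_cube V. norm (edge_product (W n) x) \<le> B ^ card E" for n
    using abs_edge_product_le[OF Wn _ bound] by (intro AE_I2) (simp add: space_lebesgue_cube)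
  show "AE x in lebesgue_cube V. (\<lambda>n. edge_product (W n) x) \<longlonglongrightarrow> edge_product U x"
    using AE_edges[OF lim] AE_space
  proof eventually_elim
    case (elim x)
    have "(\<lambda>n. on_edge (\<lambda>u v. W n (x u, x v)) e) \<longlonglongrightarrow> on_edge (\<lambda>u v. U (x u, x v)) e" if "e \<in> E" for e
    proof -
      from elim(1) that obtain u v where e: "e = {u, v}" "u \<in> V" "v \<in> V"
        "(\<lambda>n. W n (x u, x v)) \<longlonglongrightarrow> U (x u, x v)" by blast
      with elim(2) show ?thesis
        by (simp add: space_lebesgue_cube on_edge_kernel Wn W)
    qed
    then show ?case unfolding edge_product_def by (intro tendsto_prod)
  qed
qed (use measurable_edge_product Wn W in auto)

lemma hom_density_eq_0:
  assumes "W \<in> kernels" "AE p in lebesgue_on unit_square. W p = 0"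
  shows "hom_density V E W = 0"
proof -
  \<comment> \<open>The constant sequence of zero kernels converges almost everywhere to
    \<open>W\<close>.\<close>
  have "(\<lambda>n::nat. hom_density V E (\<lambda>_. 0)) \<longlonglongrightarrow> hom_density V E W"
    using assms by (intro hom_density_tendsto[where B = 0] kernels_const) auto
  then show ?thesis
    using card_edges_pos by (simp add: hom_density_const LIMSEQ_const_iff zero_power)
qed

section \<open>The candidate norm and its elementary properties\<close>

definition hom_norm :: "(real \<times> real \<Rightarrow> real) \<Rightarrow> real" where
  "hom_norm W = hom_density V E (\<lambda>p. \<bar>W p\<bar>) powr (1 / real (card E))"

lemma hom_norm_nonneg: "0 \<le> hom_norm W"
  by (simp add: hom_norm_def)

lemma hom_norm_power:
  assumes "W \<in> kernels"
  shows "hom_norm W ^ card E = hom_density V E (\<lambda>p. \<bar>W p\<bar>)"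
proof -
  have "0 \<le> hom_density V E (\<lambda>p. \<bar>W p\<bar>)"
    using assms by (intro hom_density_nonneg kernels_abs) auto
  then show ?thesis
    using card_edges_pos by (cases "hom_density V E (\<lambda>p. \<bar>W p\<bar>) = 0")
      (simp_all add: hom_norm_def powr_power)
qed

lemma hom_norm_leI:
  assumes "W \<in> kernels" "0 \<le> c" "hom_density V E (\<lambda>p. \<bar>W p\<bar>) \<le> c ^ card E"
  shows "hom_norm W \<le> c"
proof -
  have "hom_norm W ^ Suc (card E - 1) \<le> c ^ Suc (card E - 1)"
    using assms(3) card_edges_pos by (simp only: Suc_pred' [symmetric] hom_norm_power[OF assms(1)])
  then show ?thesis using assms(2) by (rule power_le_imp_le_base)
qed

lemma hom_norm_unique:
  assumes "W \<in> kernels" "0 \<le> c" "hom_density V E (\<lambda>p. \<bar>W p\<bar>) = c ^ card E"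
  shows "hom_norm W = c"
proof (rule power_eq_imp_eq_base)
  show "hom_norm W ^ card E = c ^ card E" using assms by (simp add: hom_norm_power)
qed (use assms card_edges_pos hom_norm_nonneg in auto)

lemma hom_norm_scale:
  assumes "W \<in> kernels"
  shows "hom_norm (\<lambda>p. c * W p) = \<bar>c\<bar> * hom_norm W"
  using hom_density_scale[OF kernels_abs[OF assms], of "\<bar>c\<bar>"] hom_norm_power[OF assms]
  by (intro hom_norm_unique kernels_scale assms) (simp_all add: abs_mult power_mult_distrib hom_norm_nonneg)

lemma hom_norm_mono:
  assumes "U \<in> kernels" "W \<in> kernels" "\<And>p. p \<in> unit_square \<Longrightarrow> \<bar>U p\<bar> \<le> \<bar>W p\<bar>"
  shows "hom_norm U \<le> hom_norm W"
  using hom_density_mono[OF kernels_abs[OF assms(1)] kernels_abs[OF assms(2)]] assms(3)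
  by (intro hom_norm_leI assms(1) hom_norm_nonneg) (simp add: hom_norm_power[OF assms(2)])

lemma hom_norm_tendsto:
  assumes "\<And>n. W n \<in> kernels" "U \<in> kernels" "\<And>n p. p \<in> unit_square \<Longrightarrow> \<bar>W n p\<bar> \<le> B"
    and "AE p in lebesgue_on unit_square. (\<lambda>n. W n p) \<longlonglongrightarrow> U p"
  shows "(\<lambda>n. hom_norm (W n)) \<longlonglongrightarrow> hom_norm U"
proof -
  have "(\<lambda>n. hom_density V E (\<lambda>p. \<bar>W n p\<bar>)) \<longlonglongrightarrow> hom_density V E (\<lambda>p. \<bar>U p\<bar>)"
  proof (rule hom_density_tendsto)
    show "AE p in lebesgue_on unit_square. (\<lambda>n. \<bar>W n p\<bar>) \<longlonglongrightarrow> \<bar>U p\<bar>"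
      using assms(4) by eventually_elim (rule tendsto_rabs)
  qed (use assms in \<open>auto intro: kernels_abs\<close>)
  then show ?thesis
    \<comment> \<open>The limit of the densities may be 0; there \<open>powr\<close> is still
      continuous along nonnegative bases because the exponent is positive.\<close>
    unfolding hom_norm_def using card_edges_pos assms(1)
    by (intro tendsto_powr' tendsto_const) (auto intro!: always_eventually hom_density_nonneg kernels_abs)
qed

section \<open>The triangle inequality and convexity on graphons\<close>

lemma weakly_norming_imp_convex:
  assumes "weakly_norming V E"
  shows "convex_on_graphons (hom_density V E)"
  unfolding convex_fun_on_def
proof (intro ballI allI impI conjI)
  fix U W :: "real \<times> real \<Rightarrow> real" and a b :: real
  assume UW: "U \<in> graphons" "W \<in> graphons" and ab: "0 \<le> a" "0 \<le> b" "a + b = 1"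
  let ?S = "\<lambda>p. a * U p + b * W p"
  show S: "?S \<in> graphons" by (rule graphons_convex[OF UW ab])
  \<comment> \<open>Graphons are nonnegative only on the square, so dropping the absolute value
    needs \<open>hom_density_cong\<close> rather than equality of functions.\<close>
  have norm: "hom_norm Z ^ card E = hom_density V E Z" if "Z \<in> graphons" for Z
    using that unfolding hom_norm_power[OF graphons_kernels[OF that]]
    by (intro hom_density_cong kernels_abs) (auto simp: graphons_def)
  have k: "(\<lambda>p. a * U p) \<in> kernels" "(\<lambda>p. b * W p) \<in> kernels"
    using UW by (auto intro: kernels_scale graphons_kernels)
  have "norm_on_kernels hom_norm"
    using assms unfolding weakly_norming_def hom_norm_def[abs_def] .
  then have "\<forall>U\<in>kernels. \<forall>W\<in>kernels. hom_norm (\<lambda>p. U p + W p) \<le> hom_norm U + hom_norm W"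
    unfolding norm_on_kernels_def by (elim conjE)
  from this[rule_format, OF k]
  have "hom_norm ?S \<le> hom_norm (\<lambda>p. a * U p) + hom_norm (\<lambda>p. b * W p)" .
  also have "\<dots> = a * hom_norm U + b * hom_norm W"
    using UW ab by (simp add: hom_norm_scale graphons_kernels)
  finally have "hom_norm ?S ^ card E \<le> (a * hom_norm U + b * hom_norm W) ^ card E"
    by (intro power_mono hom_norm_nonneg)
  also have "\<dots> \<le> a * hom_norm U ^ card E + b * hom_norm W ^ card E"
  proof -
    \<comment> \<open>Even powers are convex on the whole line, odd ones only on the nonnegative
      half-line, which contains all values of \<open>hom_norm\<close>.\<close>
    have "convex_on {0..} (\<lambda>x::real. x ^ card E)"
      using convex_power_odd convex_on_subset[OF convex_power_even] by (cases "even (card E)") auto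
    from convex_onD[OF this, of b "hom_norm U" "hom_norm W"] have
      "((1 - b) * hom_norm U + b * hom_norm W) ^ card E \<le>
        (1 - b) * hom_norm U ^ card E + b * hom_norm W ^ card E"
      using ab by (simp add: hom_norm_nonneg)
    moreover have "1 - b = a" using ab by simp
    ultimately show ?thesis by (simp only:)
  qed
  finally show "hom_density V E ?S \<le> a * hom_density V E U + b * hom_density V E W"
    by (simp only: norm UW S)
qed

text \<open>Homogeneity removes the upper bound 1: scaling turns both kernels into graphons, and the
  power of the scaling factor cancels.\<close>

lemma convex_nonneg_kernels:
  assumes conv: "convex_on_graphons (hom_density V E)"
    and U: "U \<in> kernels" "\<And>p. p \<in> unit_square \<Longrightarrow> 0 \<le> U p"
    and W: "W \<in> kernels" "\<And>p. p \<in> unit_square \<Longrightarrow> 0 \<le> W p"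
    and ab: "0 \<le> a" "0 \<le> b" "a + b = 1"
  shows "hom_density V E (\<lambda>p. a * U p + b * W p) \<le> a * hom_density V E U + b * hom_density V E W"
proof -
  obtain B where B: "B > 0" "\<And>p. p \<in> unit_square \<Longrightarrow> \<bar>U p\<bar> \<le> B"
    using kernels_bound[OF U(1)] by blast
  obtain C where C: "C > 0" "\<And>p. p \<in> unit_square \<Longrightarrow> \<bar>W p\<bar> \<le> C"
    using kernels_bound[OF W(1)] by blast
  \<comment> \<open>\<open>B + C\<close> dominates both kernels, so one factor serves both; two
    different factors would distort the weights \<open>a\<close> and \<open>b\<close>.\<close>
  define d where "d = 1 / (B + C)"
  have d: "d > 0" using B C by (simp add: d_def)
  have g: "(\<lambda>p. d * Z p) \<in> graphons"
    if "Z \<in> kernels" "\<And>p. p \<in> unit_square \<Longrightarrow> 0 \<le> Z p \<and> Z p \<le> B + C" for Z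
  proof -
    have "0 \<le> d * Z p \<and> d * Z p \<le> 1" if "p \<in> unit_square" for p
      using \<open>\<And>p. p \<in> unit_square \<Longrightarrow> 0 \<le> Z p \<and> Z p \<le> B + C\<close>[OF that] B(1) C(1) by (simp add: d_def)
    then show ?thesis using kernels_scale[OF that(1)] by (simp add: graphons_def)
  qed
  have gU: "(\<lambda>p. d * U p) \<in> graphons"
    using U B C by (intro g) (auto simp: add_increasing2 add_increasing dest: abs_le_D1)
  have gW: "(\<lambda>p. d * W p) \<in> graphons"
    using W B C by (intro g) (auto simp: add_increasing2 add_increasing dest: abs_le_D1)
  have "d ^ card E * hom_density V E (\<lambda>p. a * U p + b * W p) =
      hom_density V E (\<lambda>p. a * (d * U p) + b * (d * W p))"
    using hom_density_scale[of "\<lambda>p. a * U p + b * W p" d] U W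
    by (simp add: algebra_simps kernels_add kernels_scale)
  also have "\<dots> \<le> a * hom_density V E (\<lambda>p. d * U p) + b * hom_density V E (\<lambda>p. d * W p)"
    using conv[unfolded convex_fun_on_def, rule_format, OF gU gW ab] ..
  also have "\<dots> = d ^ card E * (a * hom_density V E U + b * hom_density V E W)"
    using U W by (simp add: hom_density_scale algebra_simps)
  finally show ?thesis using d by simp
qed

text \<open>The unit-ball argument, for absolute values: \<open>U / r\<close> and
  \<open>W / s\<close> have norm at most 1, and \<open>(U + W) / (r + s)\<close> is their convex
  combination with weights \<open>r / (r + s)\<close> and \<open>s / (r + s)\<close>.\<close>

lemma hom_norm_triangle:
  assumes conv: "convex_on_graphons (hom_density V E)"
    and U: "U \<in> kernels" and W: "W \<in> kernels"
  shows "hom_norm (\<lambda>p. U p + W p) \<le> hom_norm U + hom_norm W"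
proof (rule field_le_epsilon)
  fix \<epsilon> :: real assume \<epsilon>: "\<epsilon> > 0"
  \<comment> \<open>The margin keeps both divisors positive, since either norm may be 0.\<close>
  define r s where "r = hom_norm U + \<epsilon> / 2" and "s = hom_norm W + \<epsilon> / 2"
  have pos: "r > 0" "s > 0"
    using \<epsilon> hom_norm_nonneg by (simp_all add: r_def s_def add_nonneg_pos)
  have le1: "hom_density V E (\<lambda>p. 1 / c * \<bar>Z p\<bar>) \<le> 1"
    if "Z \<in> kernels" "hom_norm Z \<le> c" "c > 0" for Z c
  proof -
    have "hom_density V E (\<lambda>p. 1 / c * \<bar>Z p\<bar>) = (hom_norm Z / c) ^ card E"
      using that unfolding hom_density_scale[OF kernels_abs[OF that(1)]]
      by (simp add: hom_norm_power power_divide)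
    also have "\<dots> \<le> 1"
      using that hom_norm_nonneg by (intro power_le_one) auto
    finally show ?thesis .
  qed
  have abs: "(\<lambda>p. \<bar>U p\<bar> + \<bar>W p\<bar>) \<in> kernels"
    using U W by (intro kernels_add kernels_abs)
  have "(1 / (r + s)) ^ card E * hom_density V E (\<lambda>p. \<bar>U p\<bar> + \<bar>W p\<bar>) =
      hom_density V E (\<lambda>p. 1 / (r + s) * (\<bar>U p\<bar> + \<bar>W p\<bar>))"
    using abs by (simp only: hom_density_scale)
  also have "\<dots> = hom_density V E (\<lambda>p. r / (r + s) * (1 / r * \<bar>U p\<bar>) + s / (r + s) * (1 / s * \<bar>W p\<bar>))"
    using pos by (intro arg_cong[where f = "hom_density V E"]) (auto simp: add_divide_distrib)
  also have "\<dots> \<le> r / (r + s) * hom_density V E (\<lambda>p. 1 / r * \<bar>U p\<bar>) +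
      s / (r + s) * hom_density V E (\<lambda>p. 1 / s * \<bar>W p\<bar>)"
    using pos U W
    by (intro convex_nonneg_kernels[OF conv] kernels_scale kernels_abs)
      (auto simp: add_divide_distrib[symmetric])
  also have "\<dots> \<le> r / (r + s) * 1 + s / (r + s) * 1"
    using pos U W \<epsilon> by (intro add_mono mult_left_mono le1) (auto simp: r_def s_def)
  also have "\<dots> = 1" using pos by (simp add: add_divide_distrib[symmetric])
  finally have "hom_density V E (\<lambda>p. \<bar>U p\<bar> + \<bar>W p\<bar>) \<le> (r + s) ^ card E"
    using pos by (simp add: power_one_over divide_le_eq)
  moreover have "hom_density V E (\<lambda>p. \<bar>U p + W p\<bar>) \<le> hom_density V E (\<lambda>p. \<bar>U p\<bar> + \<bar>W p\<bar>)"
    using U W abs by (intro hom_density_mono kernels_abs kernels_add) auto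
  ultimately have "hom_norm (\<lambda>p. U p + W p) \<le> r + s"
    using U W pos by (intro hom_norm_leI kernels_add) auto
  then show "hom_norm (\<lambda>p. U p + W p) \<le> hom_norm U + hom_norm W + \<epsilon>"
    by (simp add: r_def s_def)
qed

lemma hom_norm_sum_le:
  assumes "convex_on_graphons (hom_density V E)" "finite I" "\<And>i. i \<in> I \<Longrightarrow> U i \<in> kernels"
  shows "hom_norm (\<lambda>p. \<Sum>i\<in>I. U i p) \<le> (\<Sum>i\<in>I. hom_norm (U i))"
  using assms(2,3)
proof (induction I rule: finite_induct)
  case empty
  have "hom_norm (\<lambda>p. 0) = 0"
    using card_edges_pos by (intro hom_norm_unique kernels_const) (simp_all add: hom_density_const)
  then show ?case by simp
next
  case (insert i I)
  then have "hom_norm (\<lambda>p. U i p + (\<Sum>i\<in>I. U i p)) \<le> hom_norm (U i) + hom_norm (\<lambda>p. \<Sum>i\<in>I. U i p)"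
    by (intro hom_norm_triangle[OF assms(1)] kernels_sum) auto
  with insert show ?case by simp
qed

end

section \<open>Step kernels\<close>

text \<open>The minimum puts the endpoint \<open>1\<close> into the last cell.\<close>

definition cell :: "nat \<Rightarrow> real \<Rightarrow> nat" where
  "cell m x = min (m - 1) (nat \<lfloor>real m * x\<rfloor>)"

lemma cell_less: "m > 0 \<Longrightarrow> cell m x < m"
  by (auto simp: cell_def min_def)

lemma measurable_cell [measurable]: "cell m \<in> borel \<rightarrow>\<^sub>M count_space UNIV"
  unfolding cell_def[abs_def] by measurable

lemma cell_eq_iff:
  assumes "m > 0" "0 \<le> x" "x \<le> 1" "i < m"
  shows "cell m x = i \<longleftrightarrow> real i / real m \<le> x \<and> (x < real (Suc i) / real m \<or> Suc i = m)"
proof -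
  define k where "k = nat \<lfloor>real m * x\<rfloor>"
  have k: "real j / real m \<le> x \<longleftrightarrow> j \<le> k" for j
    using assms by (simp add: k_def le_nat_iff le_floor_iff field_simps)
  have "cell m x = i \<longleftrightarrow> i \<le> k \<and> (\<not> Suc i \<le> k \<or> Suc i = m)"
    using assms(4) unfolding cell_def k_def[symmetric] by linarith
  then show ?thesis
    unfolding k[symmetric] by (simp only: not_le)
qed

text \<open>The bound is attained at \<open>x = 1\<close>, which lies in the last cell.\<close>

lemma abs_cell_le:
  assumes "m > 0" "x \<in> {0..1}"
  shows "\<bar>x - real (cell m x) / real m\<bar> \<le> 1 / real m"
proof -
  let ?c = "real (cell m x)"
  have "?c / real m \<le> x" "x < real (Suc (cell m x)) / real m \<or> Suc (cell m x) = m"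
    using cell_eq_iff[of m x "cell m x"] assms cell_less[of m x] by auto
  moreover have "x \<le> real (Suc (cell m x)) / real m" if "Suc (cell m x) = m"
    unfolding that using assms by simp
  moreover have "real (Suc (cell m x)) / real m = ?c / real m + 1 / real m"
    by (simp add: add_divide_distrib)
  ultimately show ?thesis by linarith
qed

lemma emeasure_cell:
  assumes "m > 0" "i < m"
  shows "{x \<in> {0..1}. cell m x = i} \<in> sets unit_interval"
    and "emeasure unit_interval {x \<in> {0..1}. cell m x = i} = ennreal (1 / real m)"
proof -
  define q r where "q = real i / real m" and "r = real (Suc i) / real m"
  have r: "r = q + 1 / real m" by (simp add: q_def r_def add_divide_distrib)
  have q: "0 \<le> q" "r \<le> 1" using assms by (simp_all add: q_def r_def)
  have iff: "cell m x = i \<longleftrightarrow> q \<le> x \<and> (x < r \<or> Suc i = m)" if "0 \<le> x" "x \<le> 1" for x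
    unfolding q_def r_def using assms that by (intro cell_eq_iff)
  have *: "{x \<in> {0..1}. cell m x = i} = (if Suc i = m then {q..1} else {q..<r})"
  proof (rule Set.set_eqI)
    fix x
    show "x \<in> {x \<in> {0..1}. cell m x = i} \<longleftrightarrow> x \<in> (if Suc i = m then {q..1} else {q..<r})"
    proof (cases "0 \<le> x \<and> x \<le> 1")
      case True
      then show ?thesis using iff[of x] by simp
    next
      case False
      then show ?thesis using q by auto
    qed
  qed
  show "{x \<in> {0..1}. cell m x = i} \<in> sets unit_interval"
    unfolding * using q by (auto simp: sets_restrict_space_iff)
  have "emeasure unit_interval {x \<in> {0..1}. cell m x = i} = emeasure lborel {x \<in> {0..1}. cell m x = i}"
    by (rule emeasure_restrict_space) auto
  also have "\<dots> = ennreal (1 / real m)"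
  proof (cases "Suc i = m")
    case True
    then have "r = 1" using assms by (simp add: r_def)
    with r have "1 - q = 1 / real m" by (simp add: algebra_simps)
    moreover from this have "q \<le> 1" by (smt (verit) divide_nonneg_nonneg of_nat_0_le_iff)
    ultimately show ?thesis unfolding * if_P[OF True] by (simp only: emeasure_lborel_Icc)
  next
    case False
    have "q \<le> r" "r - q = 1 / real m" unfolding r by simp_all
    then show ?thesis unfolding * if_not_P[OF False] by (simp only: emeasure_lborel_Ico)
  qed
  finally show "emeasure unit_interval {x \<in> {0..1}. cell m x = i} = ennreal (1 / real m)" .
qed

definition step_kernel :: "nat \<Rightarrow> real mat \<Rightarrow> real \<times> real \<Rightarrow> real" where
  "step_kernel m A p = A $$ (cell m (fst p), cell m (snd p))"

lemma sym_mats_sym: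
  assumes "A \<in> sym_mats m" "i < m" "j < m"
  shows "A $$ (i, j) = A $$ (j, i)"
proof -
  have A: "A \<in> carrier_mat m m" "transpose_mat A = A"
    using assms(1) by (simp_all add: sym_mats_def)
  have "A $$ (i, j) = transpose_mat A $$ (i, j)" by (simp only: A(2))
  also have "\<dots> = A $$ (j, i)" using A(1) assms(2,3) by simp
  finally show ?thesis .
qed

lemma sym_matsI: "(\<And>i j. i < m \<Longrightarrow> j < m \<Longrightarrow> f i j = f j i) \<Longrightarrow> mat m m (\<lambda>(i, j). f i j) \<in> sym_mats m"
  by (auto simp: sym_mats_def intro!: eq_matI)

lemma step_kernel_in_kernels:
  assumes "m > 0" "A \<in> sym_mats m"
  shows "step_kernel m A \<in> kernels"
proof -
  have "step_kernel m A \<in> borel_measurable borel"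
  proof -
    have "(\<lambda>p::real \<times> real. (cell m (fst p), cell m (snd p))) \<in> borel \<rightarrow>\<^sub>M count_space UNIV \<Otimes>\<^sub>M count_space UNIV"
      by (simp add: borel_prod[symmetric])
    then have "(\<lambda>p::real \<times> real. (cell m (fst p), cell m (snd p))) \<in> borel \<rightarrow>\<^sub>M count_space UNIV"
      by (simp add: pair_measure_countable)
    from measurable_compose[OF this, of "\<lambda>q. A $$ q" borel] show ?thesis
      by (simp add: step_kernel_def[abs_def])
  qed
  then have "step_kernel m A \<in> borel_measurable (lebesgue_on unit_square)"
    by (intro measurable_restrict_space1 measurable_completion) simp
  moreover have "\<bar>step_kernel m A p\<bar> \<le> (\<Sum>q\<in>{..<m} \<times> {..<m}. \<bar>A $$ q\<bar>)" for p
    unfolding step_kernel_def using assms by (intro member_le_sum) (auto simp: cell_less)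
  moreover have "step_kernel m A (x, y) = step_kernel m A (y, x)" for x y
    using assms by (simp add: step_kernel_def cell_less sym_mats_sym[OF assms(2)])
  ultimately show ?thesis
    unfolding kernels_def by blast
qed

context edged_graph
begin

lemma vertices_nonempty: "V \<noteq> {}"
  using edges_nonempty edgeE by blast

text \<open>The cube splits into boxes \<open>S \<phi>\<close>, one for each map from
  \<open>V\<close> to the cells. Each has measure \<open>(1 / m) ^ card V\<close>, and on it the
  edge product is constantly the summand of the polynomial that belongs to
  \<open>\<phi>\<close>.\<close>

lemma hom_density_step:
  assumes m: "m > 0" and A: "A \<in> sym_mats m"
  shows "hom_density V E (step_kernel m A) = hom_poly V E m A / real m ^ card V"
proof -
  interpret prob_space "lebesgue_cube V" by (rule prob_space_lebesgue_cube)
  interpret I: prob_space unit_interval by (rule prob_space_unit_interval)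
  interpret P: product_sigma_finite "\<lambda>_::'v. unit_interval" by standard
  define c where "c \<phi> = (\<Prod>e\<in>E. on_edge (\<lambda>u v. A $$ (\<phi> u, \<phi> v)) e)" for \<phi>
  define S where "S \<phi> = Pi\<^sub>E V (\<lambda>v. {x \<in> {0..1}. cell m x = \<phi> v})" for \<phi>
  let ?F = "V \<rightarrow>\<^sub>E {..<m}"
  have fin: "finite ?F" using finite_vertices by (intro finite_PiE) auto
  have S: "S \<phi> \<in> sets (lebesgue_cube V)" "measure (lebesgue_cube V) (S \<phi>) = (1 / real m) ^ card V"
    if "\<phi> \<in> ?F" for \<phi>
  proof -
    have \<phi>: "\<phi> v < m" if "v \<in> V" for v using that \<open>\<phi> \<in> ?F\<close> by auto
    have sets: "S \<phi> \<in> sets (Pi\<^sub>M V (\<lambda>_. unit_interval))"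
      unfolding S_def using finite_vertices \<phi> m by (intro sets_PiM_I_finite emeasure_cell) auto
    then show "S \<phi> \<in> sets (lebesgue_cube V)" by (simp add: lebesgue_cube_def)
    have "emeasure (Pi\<^sub>M V (\<lambda>_. unit_interval)) (S \<phi>) = (\<Prod>v\<in>V. ennreal (1 / real m))"
      unfolding S_def using finite_vertices \<phi> m
      by (subst P.emeasure_PiM) (auto simp only: emeasure_cell intro!: prod.cong)
    also have "\<dots> = ennreal ((1 / real m) ^ card V)"
      by (simp add: ennreal_power)
    finally show "measure (lebesgue_cube V) (S \<phi>) = (1 / real m) ^ card V"
      using sets by (simp add: lebesgue_cube_def measure_def)
  qed
  have eq: "edge_product (step_kernel m A) x = (\<Sum>\<phi>\<in>?F. c \<phi> * indicator (S \<phi>) x)"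
    if "x \<in> space (lebesgue_cube V)" for x
  proof -
    from that have x: "x \<in> V \<rightarrow>\<^sub>E {0..1}" by (simp add: space_lebesgue_cube)
    \<comment> \<open>The only map whose box contains \<open>x\<close>.\<close>
    define \<psi> where "\<psi> = restrict (\<lambda>v. cell m (x v)) V"
    have \<psi>: "\<psi> \<in> ?F" using m by (auto simp: \<psi>_def cell_less)
    have "x \<in> S \<phi> \<longleftrightarrow> \<phi> = \<psi>" if "\<phi> \<in> ?F" for \<phi>
      using x that by (auto simp: S_def \<psi>_def PiE_iff extensional_def restrict_def fun_eq_iff)
    then have "(\<Sum>\<phi>\<in>?F. c \<phi> * indicator (S \<phi>) x) = (\<Sum>\<phi>\<in>?F. if \<phi> = \<psi> then c \<psi> else 0)"
      by (intro sum.cong) (auto simp: indicator_def)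
    also have "\<dots> = c \<psi>" using \<psi> fin by simp
    also have "\<dots> = edge_product (step_kernel m A) x"
      unfolding c_def edge_product_def
    proof (rule prod.cong[OF refl])
      fix e assume "e \<in> E"
      then obtain u v where e: "e = {u, v}" "u \<in> V" "v \<in> V" by (rule edgeE)
      have "on_edge (\<lambda>u v. step_kernel m A (x u, x v)) e = A $$ (cell m (x u), cell m (x v))"
        using on_edge_kernel[OF step_kernel_in_kernels[OF m A] x e(2,3)] e(1) by (simp add: step_kernel_def)
      moreover have "on_edge (\<lambda>u v. A $$ (\<psi> u, \<psi> v)) e = A $$ (\<psi> u, \<psi> v)"
        unfolding e(1) using sym_mats_sym[OF A] e \<psi> by (intro on_edge_eq) auto
      ultimately show "on_edge (\<lambda>u v. A $$ (\<psi> u, \<psi> v)) e = on_edge (\<lambda>u v. step_kernel m A (x u, x v)) e"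
        using e by (simp add: \<psi>_def)
    qed
    finally show ?thesis by simp
  qed
  have int: "integrable (lebesgue_cube V) (\<lambda>x. c \<phi> * indicator (S \<phi>) x)" if "\<phi> \<in> ?F" for \<phi>
    using S[OF that] by (intro integrable_mult_right integrable_real_indicator) (auto simp: emeasure_eq_measure)
  have "hom_density V E (step_kernel m A) = (LINT x|lebesgue_cube V. (\<Sum>\<phi>\<in>?F. c \<phi> * indicator (S \<phi>) x))"
    unfolding hom_density_eq using eq by (intro Bochner_Integration.integral_cong) auto
  also have "\<dots> = (\<Sum>\<phi>\<in>?F. c \<phi> * (1 / real m) ^ card V)"
    using S int by (subst Bochner_Integration.integral_sum) (auto intro!: sum.cong)
  also have "\<dots> = hom_poly V E m A / real m ^ card V"
    by (simp add: hom_poly_def c_def sum_distrib_right[symmetric] power_inverse divide_inverse)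
  finally show ?thesis .
qed

text \<open>Composition with \<open>\<pi>\<close> is a bijection of the index set of the sum;
  \<open>restrict\<close> keeps the composed maps extensional.\<close>

lemma hom_poly_permute:
  assumes \<pi>: "\<pi> permutes {..<m}" and A: "A \<in> sym_mats m"
  shows "hom_poly V E m (mat m m (\<lambda>(i, j). A $$ (\<pi> i, \<pi> j))) = hom_poly V E m A"
  unfolding hom_poly_def
proof (rule sum.reindex_bij_witness[where i = "\<lambda>\<phi>. restrict (inv_into UNIV \<pi> \<circ> \<phi>) V" and j = "\<lambda>\<phi>. restrict (\<pi> \<circ> \<phi>) V"])
  fix \<phi> assume \<phi>: "\<phi> \<in> V \<rightarrow>\<^sub>E {..<m}"
  have \<pi>': "\<pi> i < m" "inv_into UNIV \<pi> i < m" if "i < m" for i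
    using that permutes_in_image[OF \<pi>, of i] permutes_in_image[OF permutes_inv[OF \<pi>], of i] by auto
  show "restrict (inv_into UNIV \<pi> \<circ> restrict (\<pi> \<circ> \<phi>) V) V = \<phi>" "restrict (\<pi> \<circ> restrict (inv_into UNIV \<pi> \<circ> \<phi>) V) V = \<phi>"
    using \<phi> permutes_inverses[OF \<pi>] by (auto simp: fun_eq_iff PiE_iff extensional_def)
  show "restrict (\<pi> \<circ> \<phi>) V \<in> V \<rightarrow>\<^sub>E {..<m}" "restrict (inv_into UNIV \<pi> \<circ> \<phi>) V \<in> V \<rightarrow>\<^sub>E {..<m}"
    using \<phi> \<pi>' by (auto simp: PiE_iff)
  show "(\<Prod>e\<in>E. on_edge (\<lambda>u v. A $$ (restrict (\<pi> \<circ> \<phi>) V u, restrict (\<pi> \<circ> \<phi>) V v)) e) =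
      (\<Prod>e\<in>E. on_edge (\<lambda>u v. mat m m (\<lambda>(i, j). A $$ (\<pi> i, \<pi> j)) $$ (\<phi> u, \<phi> v)) e)"
  proof (rule prod.cong[OF refl])
    fix e assume "e \<in> E"
    then obtain u v where e: "e = {u, v}" "u \<in> V" "v \<in> V" by (rule edgeE)
    have lt: "\<phi> u < m" "\<phi> v < m" using e \<phi> by auto
    have "on_edge (\<lambda>u v. A $$ (restrict (\<pi> \<circ> \<phi>) V u, restrict (\<pi> \<circ> \<phi>) V v)) e = A $$ (\<pi> (\<phi> u), \<pi> (\<phi> v))"
      unfolding e(1) using e lt \<pi>' sym_mats_sym[OF A] by (subst on_edge_eq) auto
    moreover have "on_edge (\<lambda>u v. mat m m (\<lambda>(i, j). A $$ (\<pi> i, \<pi> j)) $$ (\<phi> u, \<phi> v)) e = A $$ (\<pi> (\<phi> u), \<pi> (\<phi> v))"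
      unfolding e(1) using e lt \<pi>' sym_mats_sym[OF A] by (subst on_edge_eq) auto
    ultimately show "on_edge (\<lambda>u v. A $$ (restrict (\<pi> \<circ> \<phi>) V u, restrict (\<pi> \<circ> \<phi>) V v)) e =
       on_edge (\<lambda>u v. mat m m (\<lambda>(i, j). A $$ (\<pi> i, \<pi> j)) $$ (\<phi> u, \<phi> v)) e" by simp
  qed
qed

end

section \<open>Convexity on graphons implies convexity on positive matrices\<close>

lemma step_kernel_combine:
  assumes "m > 0" "A \<in> sym_mats m" "B \<in> sym_mats m"
  shows "step_kernel m (a \<cdot>\<^sub>m A + b \<cdot>\<^sub>m B) p = a * step_kernel m A p + b * step_kernel m B p"
  using assms by (auto simp: step_kernel_def sym_mats_def cell_less)

lemma step_kernel_pos:
  assumes "m > 0" "A \<in> pos_sym_mats m"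
  shows "step_kernel m A p > 0"
  using assms by (auto simp: step_kernel_def pos_sym_mats_def cell_less)

lemma pos_sym_mats_sym: "A \<in> pos_sym_mats m \<Longrightarrow> A \<in> sym_mats m"
  by (simp add: pos_sym_mats_def)

lemma (in edged_graph) convex_graphons_imp_convex_mats:
  assumes conv: "convex_on_graphons (hom_density V E)"
  shows "convex_on_pos_sym_mats m (hom_poly V E m)"
  unfolding convex_fun_on_def
proof (intro ballI allI impI conjI)
  fix A B :: "real mat" and a b :: real
  assume AB: "A \<in> pos_sym_mats m" "B \<in> pos_sym_mats m" and ab: "0 \<le> a" "0 \<le> b" "a + b = 1"
  let ?C = "a \<cdot>\<^sub>m A + b \<cdot>\<^sub>m B"
  show C: "?C \<in> pos_sym_mats m" by (rule pos_sym_mats_convex[OF AB ab])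
  show "hom_poly V E m ?C \<le> a * hom_poly V E m A + b * hom_poly V E m B"
  proof (cases "m = 0")
    case True
    \<comment> \<open>There is no step kernel without cells, but here the polynomial is an empty
      sum.\<close>
    then have "V \<rightarrow>\<^sub>E {..<m} = {}" using vertices_nonempty by (auto simp: PiE_eq_empty_iff)
    then show ?thesis by (simp add: hom_poly_def)
  next
    case False
    then have m: "m > 0" by simp
    note sym = AB[THEN pos_sym_mats_sym] and symC = pos_sym_mats_sym[OF C]
    \<comment> \<open>Positive entries may exceed 1, so convexity is needed in its form for
      nonnegative kernels.\<close>
    have "hom_density V E (\<lambda>p. a * step_kernel m A p + b * step_kernel m B p) \<le>
        a * hom_density V E (step_kernel m A) + b * hom_density V E (step_kernel m B)"
      using m sym ab AB[THEN step_kernel_pos[OF m], THEN less_imp_le]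
      by (intro convex_nonneg_kernels[OF conv] step_kernel_in_kernels)
    also have "(\<lambda>p. a * step_kernel m A p + b * step_kernel m B p) = step_kernel m ?C"
      using step_kernel_combine[OF m sym] by auto
    finally have "hom_poly V E m ?C / real m ^ card V \<le>
        (a * hom_poly V E m A + b * hom_poly V E m B) / real m ^ card V"
      by (simp add: hom_density_step[OF m] sym symC add_divide_distrib)
    then show ?thesis using m by (simp add: divide_le_cancel)
  qed
qed

section \<open>Approximation by step kernels\<close>

lemma AE_notin_negligible:
  assumes "negligible N"
  shows "AE p in lebesgue_on unit_square. p \<notin> N"
proof -
  have "AE p in lebesgue. p \<notin> N"
    using assms by (intro AE_not_in) (simp add: negligible_iff_null_sets)
  then show ?thesis
    unfolding AE_lebesgue_on_unit_square AE_completion_iff by eventually_elim simp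
qed

text \<open>Symmetrising an approximant also evaluates it at the reflected point, which must avoid
  the exceptional set too.\<close>

lemma negligible_swap:
  fixes N :: "(real \<times> real) set"
  assumes "negligible N"
  shows "negligible (prod.swap -` N)"
proof -
  have "prod.swap differentiable_on N"
    unfolding prod.swap_def[abs_def]
    by (intro linear_imp_differentiable_on) (auto simp: linear_iff)
  then have "negligible (prod.swap ` N)"
    using assms by (intro negligible_differentiable_image_negligible) auto
  moreover have "prod.swap -` N = prod.swap ` N" by (auto simp: image_iff) (metis swap_simp)
  ultimately show ?thesis by simp
qed

text \<open>Accuracy \<open>n\<close> and grid size \<open>m\<close> are kept apart: any grid beyond
  the threshold \<open>M n\<close> will do. Further demands, such as a common grid for two graphons,
  can then be met by enlarging \<open>k\<close>.\<close>

lemma graphon_step_approx: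
  assumes W: "W \<in> graphons"
  obtains C :: "nat \<Rightarrow> nat \<Rightarrow> real mat" and M :: "nat \<Rightarrow> nat" where
    "\<And>n m. C n m \<in> pos_sym_mats m"
    "\<And>n m i j. i < m \<Longrightarrow> j < m \<Longrightarrow> C n m $$ (i, j) \<le> 1"
    "\<And>k. (\<And>n. M n \<le> k n) \<Longrightarrow> (\<And>n. 0 < k n) \<Longrightarrow>
      AE p in lebesgue_on unit_square. (\<lambda>n. step_kernel (k n) (C n (k n)) p) \<longlonglongrightarrow> W p"
proof -
  have "W measurable_on unit_square"
    using W unit_square_lebesgue
    by (simp add: measurable_on_iff_borel_measurable graphons_def kernels_def)
  then obtain N g where N: "negligible N" and g: "\<And>n. continuous_on UNIV (g n)"
    and lim: "\<And>p. p \<notin> N \<Longrightarrow> (\<lambda>n. g n p) \<longlonglongrightarrow> (if p \<in> unit_square then W p else 0)"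
    unfolding measurable_on_def by blast
  \<comment> \<open>The average with the reflection restores symmetry, the minimum keeps entries at
    most 1, and the floor \<open>1 / (n + 1)\<close> makes them positive but vanishes in the
    limit.\<close>
  define h where "h n p = max (1 / real (Suc n)) (min 1 ((g n p + g n (prod.swap p)) / 2))" for n p
  have cont: "continuous_on UNIV (h n)" for n
  proof -
    have "continuous_on UNIV (\<lambda>p. g n (prod.swap p))"
      unfolding prod.swap_def
      by (rule continuous_on_compose2[OF g]) (auto intro!: continuous_intros)
    then show ?thesis unfolding h_def by (intro continuous_intros g) auto
  qed
  have h: "0 < h n p" "h n p \<le> 1" "h n (x, y) = h n (y, x)" for n p x y
    by (auto simp: h_def add.commute less_max_iff_disj)
  define C where "C n m = mat m m (\<lambda>(i, j). h n (real i / real m, real j / real m))" for n m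
  have "\<exists>M. \<forall>m\<ge>M. m > 0 \<longrightarrow> (\<forall>p\<in>unit_square. \<bar>step_kernel m (C n m) p - h n p\<bar> < 1 / real (Suc n))" for n
  proof -
    have "compact unit_square" by (intro compact_Times) auto
    then have "uniformly_continuous_on unit_square (h n)"
      using cont by (intro compact_uniformly_continuous) (auto intro: continuous_on_subset)
    then obtain d where d: "d > 0" "\<And>p q. p \<in> unit_square \<Longrightarrow> q \<in> unit_square \<Longrightarrow> dist q p < d \<Longrightarrow>
        dist (h n q) (h n p) < 1 / real (Suc n)"
      unfolding uniformly_continuous_on_def by (metis of_nat_0_less_iff zero_less_Suc zero_less_divide_1_iff)
    \<comment> \<open>Each coordinate is at most \<open>1 / m\<close> away from the grid point of
      its cell, so \<open>2 / m < d\<close> is enough.\<close>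
    obtain M where M: "2 / d < real M" using reals_Archimedean2 by blast
    show ?thesis
    proof (intro exI[of _ M] allI impI ballI)
      fix m p assume m: "M \<le> m" "m > 0" and "p \<in> unit_square"
      then obtain x y where p: "p = (x, y)" "x \<in> {0..1}" "y \<in> {0..1}" by blast
      let ?q = "(real (cell m x) / real m, real (cell m y) / real m)"
      have "2 / d < real m" using M m by linarith
      then have "2 / real m < d" using d m by (simp add: field_simps)
      moreover have "dist ?q p \<le> \<bar>x - fst ?q\<bar> + \<bar>y - snd ?q\<bar>"
        unfolding p(1) dist_Pair_Pair dist_real_def fst_conv snd_conv
        using sqrt_sum_squares_le_sum_abs[of "x - fst ?q" "y - snd ?q"] by (simp add: abs_minus_commute)
      ultimately have "dist ?q p < d"
        using abs_cell_le[OF m(2) p(2)] abs_cell_le[OF m(2) p(3)] unfolding fst_conv snd_conv by linarith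
      moreover have "?q \<in> unit_square"
        using cell_less[OF m(2), of x] cell_less[OF m(2), of y] by auto
      ultimately have "dist (h n ?q) (h n p) < 1 / real (Suc n)"
        using d(2) \<open>p \<in> unit_square\<close> by blast
      then show "\<bar>step_kernel m (C n m) p - h n p\<bar> < 1 / real (Suc n)"
        using cell_less[OF m(2)] by (simp add: p step_kernel_def C_def dist_real_def)
    qed
  qed
  then obtain M where M: "\<And>n m p. M n \<le> m \<Longrightarrow> m > 0 \<Longrightarrow> p \<in> unit_square \<Longrightarrow>
      \<bar>step_kernel m (C n m) p - h n p\<bar> < 1 / real (Suc n)"
    by metis
  show ?thesis
  proof (rule that)
    show "C n m \<in> pos_sym_mats m" for n m
      unfolding pos_sym_mats_def C_def using h by (auto intro!: sym_matsI)
    show "C n m $$ (i, j) \<le> 1" if "i < m" "j < m" for n m i j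
      using that h by (simp add: C_def)
    fix k :: "nat \<Rightarrow> nat" assume k: "\<And>n. M n \<le> k n" "\<And>n. 0 < k n"
    have sq: "AE p in lebesgue_on unit_square. p \<in> unit_square"
      unfolding AE_lebesgue_on_unit_square by simp
    show "AE p in lebesgue_on unit_square. (\<lambda>n. step_kernel (k n) (C n (k n)) p) \<longlonglongrightarrow> W p"
      using AE_notin_negligible[OF N] AE_notin_negligible[OF negligible_swap[OF N]] sq
    proof eventually_elim
      case (elim p)
      have lim0: "(\<lambda>n. 1 / real (Suc n)) \<longlonglongrightarrow> 0"
        using LIMSEQ_inverse_real_of_nat by (simp add: inverse_eq_divide)
      have "prod.swap p \<in> unit_square" using elim(3) by auto
      moreover have "W (prod.swap p) = W p" "0 \<le> W p" "W p \<le> 1"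
        using W elim(3) by (auto simp: graphons_def kernels_def)
      ultimately have "(\<lambda>n. h n p) \<longlonglongrightarrow> max 0 (min 1 ((W p + W p) / 2))"
        unfolding h_def using lim[of p] lim[of "prod.swap p"] elim
        by (intro tendsto_intros lim0) simp_all
      then have "(\<lambda>n. h n p) \<longlonglongrightarrow> W p" using \<open>0 \<le> W p\<close> \<open>W p \<le> 1\<close> by simp
      moreover have "(\<lambda>n. step_kernel (k n) (C n (k n)) p - h n p) \<longlonglongrightarrow> 0"
        using M[OF k elim(3), THEN less_imp_le] by (intro Lim_null_comparison[OF _ lim0] always_eventually) simp
      ultimately show ?case
        using tendsto_add[of "\<lambda>n. step_kernel (k n) (C n (k n)) p - h n p" 0 sequentially "\<lambda>n. h n p" "W p"] by simp
    qed
  qed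
qed

lemma abs_step_kernel_le:
  assumes "m > 0" "A \<in> pos_sym_mats m" "\<And>i j. i < m \<Longrightarrow> j < m \<Longrightarrow> A $$ (i, j) \<le> 1"
  shows "\<bar>step_kernel m A p\<bar> \<le> 1"
  using step_kernel_pos[OF assms(1,2), of p] assms(1,3) by (simp add: step_kernel_def cell_less)

lemma (in edged_graph) convex_mats_imp_convex_graphons:
  assumes conv: "\<And>m. convex_on_pos_sym_mats m (hom_poly V E m)"
  shows "convex_on_graphons (hom_density V E)"
  unfolding convex_fun_on_def
proof (intro ballI allI impI conjI)
  fix U W :: "real \<times> real \<Rightarrow> real" and a b :: real
  assume UW: "U \<in> graphons" "W \<in> graphons" and ab: "0 \<le> a" "0 \<le> b" "a + b = 1"
  show "(\<lambda>p. a * U p + b * W p) \<in> graphons" by (rule graphons_convex[OF UW ab])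
  obtain A M where A: "\<And>n m. A n m \<in> pos_sym_mats m" "\<And>n m i j. i < m \<Longrightarrow> j < m \<Longrightarrow> A n m $$ (i, j) \<le> 1"
    "\<And>k. (\<And>n. M n \<le> k n) \<Longrightarrow> (\<And>n. 0 < k n) \<Longrightarrow>
      AE p in lebesgue_on unit_square. (\<lambda>n. step_kernel (k n) (A n (k n)) p) \<longlonglongrightarrow> U p"
    using graphon_step_approx[OF UW(1)] by blast
  obtain B L where B: "\<And>n m. B n m \<in> pos_sym_mats m" "\<And>n m i j. i < m \<Longrightarrow> j < m \<Longrightarrow> B n m $$ (i, j) \<le> 1"
    "\<And>k. (\<And>n. L n \<le> k n) \<Longrightarrow> (\<And>n. 0 < k n) \<Longrightarrow>
      AE p in lebesgue_on unit_square. (\<lambda>n. step_kernel (k n) (B n (k n)) p) \<longlonglongrightarrow> W p"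
    using graphon_step_approx[OF UW(2)] by blast
  \<comment> \<open>One grid for both graphons, because the hypothesis compares only matrices of
    equal size; \<open>Suc\<close> makes it nonempty.\<close>
  define k where "k n = Suc (M n + L n)" for n
  have k: "k n > 0" "M n \<le> k n" "L n \<le> k n" for n by (simp_all add: k_def)
  define F where "F n = step_kernel (k n) (A n (k n))" for n
  define G where "G n = step_kernel (k n) (B n (k n))" for n
  have FG: "F n \<in> kernels" "G n \<in> kernels" "\<bar>F n p\<bar> \<le> 1" "\<bar>G n p\<bar> \<le> 1" for n p
    unfolding F_def G_def using A(1,2) B(1,2) k
    by (auto intro!: step_kernel_in_kernels pos_sym_mats_sym abs_step_kernel_le)
  have limF: "AE p in lebesgue_on unit_square. (\<lambda>n. F n p) \<longlonglongrightarrow> U p"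
    unfolding F_def by (rule A(3)) (use k in auto)
  have limG: "AE p in lebesgue_on unit_square. (\<lambda>n. G n p) \<longlonglongrightarrow> W p"
    unfolding G_def by (rule B(3)) (use k in auto)
  have "(\<lambda>n. hom_density V E (\<lambda>p. a * F n p + b * G n p)) \<longlonglongrightarrow> hom_density V E (\<lambda>p. a * U p + b * W p)"
  proof (rule hom_density_tendsto)
    show "\<bar>a * F n p + b * G n p\<bar> \<le> 1" for n p
    proof -
      have "\<bar>a * F n p + b * G n p\<bar> \<le> a * \<bar>F n p\<bar> + b * \<bar>G n p\<bar>"
        using abs_triangle_ineq[of "a * F n p" "b * G n p"] ab by (simp add: abs_mult)
      also have "\<dots> \<le> a * 1 + b * 1" using ab FG by (intro add_mono mult_left_mono)
      finally show ?thesis using ab by simp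
    qed
    show "AE p in lebesgue_on unit_square. (\<lambda>n. a * F n p + b * G n p) \<longlonglongrightarrow> a * U p + b * W p"
      using limF limG by eventually_elim (intro tendsto_intros)
  qed (use FG UW[THEN graphons_kernels] in \<open>auto intro!: kernels_add kernels_scale\<close>)
  moreover have "(\<lambda>n. a * hom_density V E (F n) + b * hom_density V E (G n)) \<longlonglongrightarrow>
      a * hom_density V E U + b * hom_density V E W"
    using FG UW limF limG
    by (intro tendsto_intros hom_density_tendsto[where B = 1]) (auto intro: graphons_kernels)
  moreover have "hom_density V E (\<lambda>p. a * F n p + b * G n p) \<le> a * hom_density V E (F n) + b * hom_density V E (G n)" for n
  proof -
    let ?C = "a \<cdot>\<^sub>m A n (k n) + b \<cdot>\<^sub>m B n (k n)"
    have C: "?C \<in> pos_sym_mats (k n)"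
      and le: "hom_poly V E (k n) ?C \<le> a * hom_poly V E (k n) (A n (k n)) + b * hom_poly V E (k n) (B n (k n))"
      using conv[of "k n", unfolded convex_fun_on_def, rule_format, OF A(1) B(1) ab] by auto
    note sym = pos_sym_mats_sym[OF A(1)[of n "k n"]] pos_sym_mats_sym[OF B(1)[of n "k n"]] pos_sym_mats_sym[OF C]
    have "(\<lambda>p. a * F n p + b * G n p) = step_kernel (k n) ?C"
      unfolding F_def G_def using step_kernel_combine[OF k(1) sym(1,2)] by auto
    then show ?thesis
      unfolding F_def G_def
      using divide_right_mono[OF le, of "real (k n) ^ card V"] sym
      by (simp add: hom_density_step[OF k(1)] add_divide_distrib)
  qed
  ultimately show "hom_density V E (\<lambda>p. a * U p + b * W p) \<le> a * hom_density V E U + b * hom_density V E W"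
    by (auto intro: LIMSEQ_le)
qed

section \<open>Edge density and definiteness\<close>

lemma permutes_pair_transitive:
  assumes "i \<in> S" "j \<in> S" "i' \<in> S" "j' \<in> S" "i \<noteq> j" "i' \<noteq> j'"
  obtains \<sigma> where "\<sigma> permutes S" "\<sigma> i = i'" "\<sigma> j = j'"
proof -
  let ?j = "Transposition.transpose i i' j"
  have "?j \<in> S" "?j \<noteq> i'" using assms by (auto simp: Transposition.transpose_def)
  with assms show ?thesis
    \<comment> \<open>The second transposition moves \<open>?j\<close> to \<open>j'\<close> and
      fixes \<open>i'\<close>, because neither \<open>?j\<close> nor \<open>j'\<close> equals
      \<open>i'\<close>.\<close>
    by (intro that[of "Transposition.transpose ?j j' \<circ> Transposition.transpose i i'"] permutes_compose permutes_swap_id)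
       (auto simp: Transposition.transpose_def)
qed

text \<open>The symmetric group is doubly transitive, and composing with a permutation that carries
  one pair to the other merely reorders the sum. This is what makes averaged matrices constant off
  the diagonal.\<close>

lemma sum_permutations_pair:
  assumes "i \<in> S" "j \<in> S" "i' \<in> S" "j' \<in> S" "i \<noteq> j" "i' \<noteq> j'"
  shows "(\<Sum>\<pi> | \<pi> permutes S. f (\<pi> i) (\<pi> j)) = (\<Sum>\<pi> | \<pi> permutes S. f (\<pi> i') (\<pi> j'))"
proof -
  obtain \<sigma> where \<sigma>: "\<sigma> permutes S" "\<sigma> i = i'" "\<sigma> j = j'"
    using permutes_pair_transitive[OF assms] by blast
  show ?thesis
    using sum_permutations_compose_right[OF \<sigma>(1), of "\<lambda>\<pi>. f (\<pi> i) (\<pi> j)"] \<sigma>(2,3) by simp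
qed

text \<open>The integral of \<open>W\<close> is treated as the density of a one-edge graph on the
  same \<open>V\<close>, so that the results on step kernels, relabelling and limits apply to it as
  well.\<close>

lemma edge_density_eq:
  assumes "W \<in> kernels" "u \<in> V" "v \<in> V"
  shows "hom_density V {{u, v}} W = (LINT x|lebesgue_cube V. W (x u, x v))"
  unfolding hom_density_def
proof (intro Bochner_Integration.integral_cong refl)
  fix x assume "x \<in> space (lebesgue_cube V)"
  then have "x u \<in> {0..1}" "x v \<in> {0..1}" using assms by (auto simp: space_lebesgue_cube)
  then have "W (x u, x v) = W (x v, x u)" using assms(1) unfolding kernels_def by blast
  then show "(\<Prod>e\<in>{{u, v}}. on_edge (\<lambda>u v. W (x u, x v)) e) = W (x u, x v)"
    by (simp add: on_edge_eq)
qed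

lemma integrable_kernel_cube:
  assumes "W \<in> kernels" "finite V" "u \<in> V" "v \<in> V" "u \<noteq> v"
  shows "integrable (lebesgue_cube V) (\<lambda>x. W (x u, x v))"
proof -
  interpret prob_space "lebesgue_cube V" by (rule prob_space_lebesgue_cube)
  obtain B where B: "\<And>p. p \<in> unit_square \<Longrightarrow> \<bar>W p\<bar> \<le> B" using kernels_bound[OF assms(1)] by blast
  show ?thesis
  proof (rule integrable_const_bound[where B = B])
    show "AE x in lebesgue_cube V. norm (W (x u, x v)) \<le> B"
    proof (rule AE_I2)
      fix x assume "x \<in> space (lebesgue_cube V)"
      then have "(x u, x v) \<in> unit_square" using assms by (auto simp: space_lebesgue_cube)
      from B[OF this] show "norm (W (x u, x v)) \<le> B" by simp
    qed
    show "(\<lambda>x. W (x u, x v)) \<in> borel_measurable (lebesgue_cube V)"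
      using assms by (intro measurable_kernel_cube) (auto simp: kernels_def)
  qed
qed

text \<open>The adjacency matrix of the complete graph; its step kernel replaces the constant 1 on a
  finite grid.\<close>

definition off_diagonal :: "nat \<Rightarrow> real mat" where
  "off_diagonal m = mat m m (\<lambda>(i, j). if i = j then 0 else 1)"

lemma off_diagonal_sym: "off_diagonal m \<in> sym_mats m"
  unfolding off_diagonal_def by (rule sym_matsI) auto

lemma step_off_diagonal:
  "m > 0 \<Longrightarrow> step_kernel m (off_diagonal m) p = (if cell m (fst p) = cell m (snd p) then 0 else 1)"
  by (simp add: step_kernel_def off_diagonal_def cell_less)

lemma AE_step_off_diagonal:
  assumes "\<And>n. n < k n"
  shows "AE p in lebesgue_on unit_square. (\<lambda>n. step_kernel (k n) (off_diagonal (k n)) p) \<longlonglongrightarrow> 1"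
proof -
  \<comment> \<open>The diagonal of the plane, written as a hyperplane.\<close>
  have "negligible {p :: real \<times> real. (1, -1) \<bullet> p = 0}"
    by (rule negligible_hyperplane) (simp add: zero_prod_def)
  from AE_notin_negligible[OF this] 
  have ae: "AE p in lebesgue_on unit_square. fst p \<noteq> snd p"
    by eventually_elim (auto simp: inner_prod_def)
  have sq: "AE p in lebesgue_on unit_square. p \<in> unit_square"
    unfolding AE_lebesgue_on_unit_square by simp
  show ?thesis using ae sq
  proof eventually_elim
    case (elim p)
    obtain x y where p: "p = (x, y)" "x \<in> {0..1}" "y \<in> {0..1}" using elim(2) by blast
    have "x \<noteq> y" using elim(1) p by simp
    then obtain M where M: "2 / \<bar>x - y\<bar> < real M" using reals_Archimedean2 by blast
    have "step_kernel (k n) (off_diagonal (k n)) p = 1" if "n \<ge> M" for n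
    proof -
      have k: "k n > 0" "real M < real (k n)" using assms[of n] that by auto
      have "2 / \<bar>x - y\<bar> < real (k n)" using M k by linarith
      \<comment> \<open>Two points of one cell are within \<open>1 / k n\<close> of the same grid
        point, hence at most \<open>2 / k n\<close> apart.\<close>
      then have "2 / real (k n) < \<bar>x - y\<bar>" using k \<open>x \<noteq> y\<close> by (simp add: field_simps)
      then have "cell (k n) x \<noteq> cell (k n) y"
        using abs_cell_le[OF k(1) p(2)] abs_cell_le[OF k(1) p(3)] by (auto simp: abs_le_iff abs_if split: if_splits)
      then show ?thesis using k p by (simp add: step_off_diagonal)
    qed
    then show ?case
      by (intro tendsto_eventually eventually_sequentiallyI[of M])
  qed
qed

text \<open>Averaging \<open>A\<close> over all relabellings of \<open>{..<m}\<close> makes it constant off the diagonal, and the triangle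
  inequality shows that this does not increase the norm. The diagonal blocks account for the error
  term.\<close>

lemma (in edged_graph) edge_density_step_le:
  assumes conv: "convex_on_graphons (hom_density V E)"
    and uv: "u \<in> V" "v \<in> V" "u \<noteq> v"
    and m: "m \<ge> 2" and A: "A \<in> sym_mats m" "\<And>i j. i < m \<Longrightarrow> j < m \<Longrightarrow> 0 \<le> A $$ (i, j) \<and> A $$ (i, j) \<le> 1"
  shows "hom_density V {{u, v}} (step_kernel m A) * hom_norm (step_kernel m (off_diagonal m)) \<le>
    hom_norm (step_kernel m A) + (1 - hom_density V {{u, v}} (step_kernel m (off_diagonal m)))"
proof -
  interpret prob_space "lebesgue_cube V" by (rule prob_space_lebesgue_cube)
  interpret G: edged_graph V "{{u, v}}"
    using uv finite_vertices by unfold_locales (auto simp: simple_graph_def)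
  let ?D = "hom_density V {{u, v}}" and ?off = "step_kernel m (off_diagonal m)"
  define P where "P = {\<pi>. \<pi> permutes {..<m}}"
  have P: "finite P" "card P > 0"
    by (simp_all add: P_def finite_permutations card_permutations)
  define B where "B \<pi> = mat m m (\<lambda>(i, j). A $$ (\<pi> i, \<pi> j))" for \<pi>
  \<comment> \<open>By double transitivity any two distinct indices give the same sum; 0 and 1 are
    available because \<open>m \<ge> 2\<close>.\<close>
  define s where "s = (\<Sum>\<pi>\<in>P. A $$ (\<pi> 0, \<pi> 1))"
  \<comment> \<open>The sum over all relabellings instead of their average; the factor
    \<open>card P\<close> is cancelled at the end.\<close>
  define K where "K p = (\<Sum>\<pi>\<in>P. step_kernel m (B \<pi>) p)" for p
  have m0: "m > 0" using m by simp
  have \<pi>: "\<pi> i < m" if "\<pi> \<in> P" "i < m" for \<pi> i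
    using that permutes_in_image[of \<pi> "{..<m}" i] by (auto simp: P_def)
  have B: "B \<pi> \<in> sym_mats m" if "\<pi> \<in> P" for \<pi>
    unfolding B_def using sym_mats_sym[OF A(1)] \<pi>[OF that] by (intro sym_matsI) auto
  have stepB: "step_kernel m (B \<pi>) p = A $$ (\<pi> (cell m (fst p)), \<pi> (cell m (snd p)))" for \<pi> p
    by (simp add: step_kernel_def B_def cell_less m0)
  have stepB01: "0 \<le> step_kernel m (B \<pi>) p" "step_kernel m (B \<pi>) p \<le> 1" if "\<pi> \<in> P" for \<pi> p
    using A(2) \<pi>[OF that] by (simp_all add: stepB cell_less m0)
  have offk: "?off \<in> kernels" by (intro step_kernel_in_kernels m0 off_diagonal_sym)
  have Ak: "step_kernel m A \<in> kernels" by (intro step_kernel_in_kernels m0 A)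
  have Bk: "step_kernel m (B \<pi>) \<in> kernels" if "\<pi> \<in> P" for \<pi>
    using that by (intro step_kernel_in_kernels m0 B)
  have Kk: "K \<in> kernels" unfolding K_def[abs_def] using P Bk by (intro kernels_sum)
  have s0: "0 \<le> s" unfolding s_def using A(2) \<pi> m by (intro sum_nonneg) auto
  have Koff: "K p = s" if "cell m (fst p) \<noteq> cell m (snd p)" for p
    unfolding K_def s_def stepB P_def
    using that m by (intro sum_permutations_pair) (auto simp: cell_less)
  have K0: "0 \<le> K p" for p unfolding K_def using stepB01 by (intro sum_nonneg)
  have K1: "K p \<le> real (card P)" for p
    unfolding K_def using sum_bounded_above[of P "\<lambda>\<pi>. step_kernel m (B \<pi>) p" 1] stepB01 by simp

  \<comment> \<open>On the diagonal blocks only \<open>0 \<le> K p\<close> is used, so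
    \<open>K\<close> is bounded below by \<open>s\<close> times the off-diagonal kernel.\<close>
  have "s * hom_norm ?off = hom_norm (\<lambda>p. s * ?off p)"
    using s0 by (simp add: hom_norm_scale offk)
  also have "\<dots> \<le> hom_norm K"
    using s0 K0 by (intro hom_norm_mono kernels_scale offk Kk) (auto simp: step_off_diagonal m0 Koff)
  also have "\<dots> \<le> (\<Sum>\<pi>\<in>P. hom_norm (step_kernel m (B \<pi>)))"
    unfolding K_def[abs_def] using P Bk by (intro hom_norm_sum_le[OF conv])
  also have "\<dots> = (\<Sum>\<pi>\<in>P. hom_norm (step_kernel m A))"
  proof (rule sum.cong[OF refl])
    fix \<pi> assume "\<pi> \<in> P"
    then have "hom_poly V E m (B \<pi>) = hom_poly V E m A"
      unfolding B_def using A(1) by (intro hom_poly_permute) (simp_all add: P_def)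
    moreover have "(\<lambda>p. \<bar>step_kernel m (B \<pi>) p\<bar>) = step_kernel m (B \<pi>)"
      using stepB01(1)[OF \<open>\<pi> \<in> P\<close>] by auto
    moreover have "(\<lambda>p. \<bar>step_kernel m A p\<bar>) = step_kernel m A"
      using A(2) by (auto simp: step_kernel_def cell_less m0)
    ultimately show "hom_norm (step_kernel m (B \<pi>)) = hom_norm (step_kernel m A)"
      using B[OF \<open>\<pi> \<in> P\<close>] A(1) by (simp add: hom_norm_def hom_density_step m0)
  qed
  finally have s_le: "s * hom_norm ?off \<le> card P * hom_norm (step_kernel m A)" by simp

  note intk = integrable_kernel_cube[OF _ finite_vertices uv]
  have D: "?D W = (LINT x|lebesgue_cube V. W (x u, x v))" if "W \<in> kernels" for W
    using that uv(1,2) by (rule edge_density_eq)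
  have off01: "0 \<le> ?off p" "?off p \<le> 1" for p by (simp_all add: step_off_diagonal m0)
  have "?D ?off \<le> ?D (\<lambda>p. 1)"
    using off01 by (intro G.hom_density_mono offk kernels_const) auto
  then have Doff: "?D ?off \<le> 1" by (simp add: G.hom_density_const)
  have "hom_norm ?off \<le> 1"
    using hom_density_mono[OF kernels_abs[OF offk] kernels_const[of 1]] off01
    by (intro hom_norm_leI offk) (simp_all add: hom_density_const)
  have "?D K = (\<Sum>\<pi>\<in>P. ?D (step_kernel m (B \<pi>)))"
    unfolding D[OF Kk] unfolding K_def using Bk intk
    by (subst Bochner_Integration.integral_sum) (auto simp: D intro!: sum.cong)
  also have "\<dots> = (\<Sum>\<pi>\<in>P. ?D (step_kernel m A))"
  proof (rule sum.cong[OF refl])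
    fix \<pi> assume "\<pi> \<in> P"
    then have "hom_poly V {{u, v}} m (B \<pi>) = hom_poly V {{u, v}} m A"
      unfolding B_def using A(1) by (intro G.hom_poly_permute) (simp_all add: P_def)
    then show "?D (step_kernel m (B \<pi>)) = ?D (step_kernel m A)"
      using B[OF \<open>\<pi> \<in> P\<close>] A(1) by (simp add: G.hom_density_step m0)
  qed
  finally have DK: "?D K = card P * ?D (step_kernel m A)" by simp
  \<comment> \<open>Conversely \<open>K\<close> equals \<open>s\<close> off the diagonal blocks and
    is at most \<open>card P\<close> on them, since each summand is at most 1.\<close>
  have "?D K \<le> (LINT x|lebesgue_cube V. s * ?off (x u, x v) + card P * (1 - ?off (x u, x v)))"
    unfolding D[OF Kk]
  proof (rule integral_mono)
    show "K (x u, x v) \<le> s * ?off (x u, x v) + card P * (1 - ?off (x u, x v))" for x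
      using K1[of "(x u, x v)"] Koff[of "(x u, x v)"] by (simp add: step_off_diagonal m0)
  qed (use intk[OF Kk] intk[OF offk] in auto)
  also have "\<dots> = s * ?D ?off + card P * (1 - ?D ?off)"
    using intk[OF offk] by (simp add: D[OF offk] prob_space)
  also have "\<dots> \<le> s * 1 + card P * (1 - ?D ?off)"
    using s0 Doff by (intro add_mono mult_left_mono) auto
  finally have "card P * ?D (step_kernel m A) \<le> s + card P * (1 - ?D ?off)"
    by (simp add: DK)
  \<comment> \<open>After this multiplication \<open>s_le\<close> eliminates \<open>s\<close>; the
    error term does not grow because the norm of \<open>?off\<close> is at most 1.\<close>
  then have "card P * ?D (step_kernel m A) * hom_norm ?off \<le> (s + card P * (1 - ?D ?off)) * hom_norm ?off"
    by (intro mult_right_mono hom_norm_nonneg)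
  also have "\<dots> = s * hom_norm ?off + card P * (1 - ?D ?off) * hom_norm ?off"
    by (simp only: distrib_right)
  also have "\<dots> \<le> card P * hom_norm (step_kernel m A) + card P * (1 - ?D ?off) * 1"
    using s_le Doff \<open>hom_norm ?off \<le> 1\<close> by (intro add_mono mult_left_mono) auto
  also have "\<dots> = card P * (hom_norm (step_kernel m A) + (1 - ?D ?off))"
    by (simp only: distrib_left mult_1_right)
  finally show ?thesis
    using P(2) by (simp only: mult.assoc mult_le_cancel_left_pos of_nat_0_less_iff)
qed

text \<open>Sidorenko's inequality for \<open>H\<close>: the homomorphism density is at least the edge density to the
  power \<open>card E\<close>.\<close>

lemma (in edged_graph) edge_density_le_hom_norm:
  assumes conv: "convex_on_graphons (hom_density V E)"
    and uv: "u \<in> V" "v \<in> V" "u \<noteq> v" and W: "W \<in> graphons"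
  shows "hom_density V {{u, v}} W \<le> hom_norm W"
proof -
  interpret G: edged_graph V "{{u, v}}"
    using uv finite_vertices by unfold_locales (auto simp: simple_graph_def)
  let ?D = "hom_density V {{u, v}}"
  obtain A M where A: "\<And>n m. A n m \<in> pos_sym_mats m" "\<And>n m i j. i < m \<Longrightarrow> j < m \<Longrightarrow> A n m $$ (i, j) \<le> 1"
    "\<And>k. (\<And>n. M n \<le> k n) \<Longrightarrow> (\<And>n. 0 < k n) \<Longrightarrow>
      AE p in lebesgue_on unit_square. (\<lambda>n. step_kernel (k n) (A n (k n)) p) \<longlonglongrightarrow> W p"
    using graphon_step_approx[OF W] by blast
  \<comment> \<open>The summand \<open>n\<close> makes the diagonal blocks shrink,
    \<open>M n\<close> meets the approximation threshold, and 2 provides two distinct cells.\<close>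
  define k where "k n = n + M n + 2" for n
  have k: "k n > 0" "M n \<le> k n" "n < k n" "2 \<le> k n" for n by (simp_all add: k_def)
  define F where "F n = step_kernel (k n) (A n (k n))" for n
  define Q where "Q n = step_kernel (k n) (off_diagonal (k n))" for n
  have F: "F n \<in> kernels" "Q n \<in> kernels" "\<bar>F n p\<bar> \<le> 1" "\<bar>Q n p\<bar> \<le> 1" for n p
    unfolding F_def Q_def using A(1,2) k(1)
    by (auto intro!: step_kernel_in_kernels pos_sym_mats_sym abs_step_kernel_le off_diagonal_sym simp: step_off_diagonal)
  have limF: "AE p in lebesgue_on unit_square. (\<lambda>n. F n p) \<longlonglongrightarrow> W p"
    unfolding F_def by (rule A(3)) (use k in auto)
  have limQ: "AE p in lebesgue_on unit_square. (\<lambda>n. Q n p) \<longlonglongrightarrow> 1"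
    unfolding Q_def using k(3) by (rule AE_step_off_diagonal)
  note Wk = graphons_kernels[OF W]
  have one: "hom_norm (\<lambda>p. 1) = 1"
    by (intro hom_norm_unique kernels_const) (simp_all add: hom_density_const)
  \<comment> \<open>The constant 1 has norm and edge density 1, so in the limit the factor becomes 1
    and the error becomes 0.\<close>
  have "(\<lambda>n. ?D (F n) * hom_norm (Q n)) \<longlonglongrightarrow> ?D W * hom_norm (\<lambda>p. 1)"
    using F limF limQ Wk
    by (intro tendsto_mult G.hom_density_tendsto[where B = 1] hom_norm_tendsto[where B = 1] kernels_const) auto
  moreover have "(\<lambda>n. hom_norm (F n) + (1 - ?D (Q n))) \<longlonglongrightarrow> hom_norm W + (1 - ?D (\<lambda>p. 1))"
    using F limF limQ Wk
    by (intro tendsto_intros G.hom_density_tendsto[where B = 1] hom_norm_tendsto[where B = 1] kernels_const) auto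
  moreover have "?D (F n) * hom_norm (Q n) \<le> hom_norm (F n) + (1 - ?D (Q n))" for n
    unfolding F_def Q_def using A(1)[of n "k n"] A(2)[of _ "k n" _ n]
    by (intro edge_density_step_le[OF conv uv k(4)]) (auto simp: pos_sym_mats_def less_imp_le)
  ultimately have "?D W * hom_norm (\<lambda>p. 1) \<le> hom_norm W + (1 - ?D (\<lambda>p. 1))"
    by (auto intro: LIMSEQ_le)
  then show ?thesis by (simp add: one G.hom_density_const)
qed

text \<open>Once \<open>\<bar>W\<bar>\<close> is scaled to a graphon, the Sidorenko bound makes its
  integral along one edge vanish. A nonnegative integrand with integral 0 is 0 almost everywhere on
  the cube, and this is carried back to the square.\<close>

lemma (in edged_graph) hom_norm_eq_0D:
  assumes conv: "convex_on_graphons (hom_density V E)"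
    and W: "W \<in> kernels" "hom_norm W = 0"
  shows "AE p in lebesgue_on unit_square. W p = 0"
proof -
  obtain e where "e \<in> E" using edges_nonempty by blast
  then obtain u v where uv: "u \<in> V" "v \<in> V" "u \<noteq> v" by (rule edgeE)
  obtain B where B: "B > 0" "\<And>p. p \<in> unit_square \<Longrightarrow> \<bar>W p\<bar> \<le> B" using kernels_bound[OF W(1)] by blast
  define U where "U p = 1 / B * \<bar>W p\<bar>" for p
  have U: "U \<in> kernels" unfolding U_def by (intro kernels_scale kernels_abs W)
  have U0: "0 \<le> U p" for p using B(1) by (simp add: U_def)
  have "U p \<le> 1" if "p \<in> unit_square" for p
    using B(1) B(2)[OF that] by (simp add: U_def)
  with U U0 have Ug: "U \<in> graphons" by (simp add: graphons_def)
  have "hom_norm (\<lambda>p. \<bar>W p\<bar>) = 0" using W(2) by (simp add: hom_norm_def)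
  then have "hom_norm U = 0"
    unfolding U_def using hom_norm_scale[OF kernels_abs[OF W(1)], of "1 / B"] by simp
  with edge_density_le_hom_norm[OF conv uv Ug] have "(LINT x|lebesgue_cube V. U (x u, x v)) \<le> 0"
    by (simp add: edge_density_eq[OF U uv(1,2)])
  moreover have "0 \<le> (LINT x|lebesgue_cube V. U (x u, x v))"
    using U0 by (intro Bochner_Integration.integral_nonneg)
  ultimately have "(LINT x|lebesgue_cube V. U (x u, x v)) = 0" by simp
  then have "AE x in lebesgue_cube V. U (x u, x v) = 0"
    using integral_nonneg_eq_0_iff_AE[OF integrable_kernel_cube[OF U finite_vertices uv]] U0 by simp
  then have "AE p in lebesgue_on unit_square. U p = 0"
    using U by (intro AE_cube_kernel_eq_0D[OF finite_vertices uv]) (auto simp: kernels_def)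
  then show ?thesis
    by eventually_elim (use B(1) in \<open>simp add: U_def\<close>)
qed

lemma (in edged_graph) convex_imp_weakly_norming:
  assumes conv: "convex_on_graphons (hom_density V E)"
  shows "weakly_norming V E"
proof -
  have "hom_norm W = 0" if "W \<in> kernels" "AE p in lebesgue_on unit_square. W p = 0" for W
  proof -
    have "AE p in lebesgue_on unit_square. \<bar>W p\<bar> = 0" using that(2) by eventually_elim simp
    from hom_density_eq_0[OF kernels_abs[OF that(1)] this] show ?thesis by (simp add: hom_norm_def)
  qed
  then have "norm_on_kernels hom_norm"
    unfolding norm_on_kernels_def
    using hom_norm_nonneg hom_norm_scale hom_norm_triangle[OF conv] hom_norm_eq_0D[OF conv] by blast
  then show ?thesis unfolding weakly_norming_def hom_norm_def[abs_def] .
qed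

theorem theorem3p1:
  fixes V :: "'v set" and E :: "'v set set"
  assumes "simple_graph V E" and "E \<noteq> {}"
  shows "(weakly_norming V E \<longleftrightarrow> convex_on_graphons (hom_density V E)) \<and>
         (convex_on_graphons (hom_density V E) \<longleftrightarrow>
            (\<forall>n. convex_on_pos_sym_mats n (hom_poly V E n)))"
proof -
  interpret edged_graph V E using assms by unfold_locales
  show ?thesis
    using weakly_norming_imp_convex convex_imp_weakly_norming
      convex_graphons_imp_convex_mats convex_mats_imp_convex_graphons by blast
qed

end
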